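(* Let $IMC$ be an infinite magic carpet graph with either torus identifications or Klein bottle identifications, and let $x$ be a cell (vertex) of $IMC$. Then $\# B(x,r) \sim r^3$; that is, there are constants $c, C > 0$ such that, for all sufficiently large $r$, \[ c\, r^3 \le \# B(x,r) \le C\, r^3 . \]
   Context: Complex $V_m$. For $m\ge 0$ divide $Q_m=[0,3^m]^2$ into closed unit squares $[a,a+1]\times[b,b+1]$, $0\le a,b<3^m$ integers with base-3 digits $a=\sum_{j<m} a_j3^j$, $b=\sum_{j<m} b_j3^j$. The cells are the $8^m$ unit squares with $(a_j,b_j)\ne(1,1)$ for all $j<m$. The deleted region is the union of the vacant squares: a vacant square of side $s=3^j$ ($0\le j\le m-1$) is the central $3^j\times 3^j$ subsquare of a triadic block of side $3^{j+1}$, the block not being contained in a larger vacant square. For every vacant square $[p,p+s]\times[q,q+s]$ its opposite sides are identified, for $0\le t\le s$, by: torus type: $(p,q+t)\sim(p+s,q+t)$ and $(p+t,q)\sim(p+t,q+s)$; Klein bottle type: one of the two pairs of opposite sides is identified as in the torus type, and the other with reversed orientation (i.e. $(p+t,q)\sim(p+s-t,q+s)$, or else $(p,q+t)\sim(p+s,q+s-t)$), the same choice of reversed direction being used at all vacant squares. The same identification type is used at all vacant squares. The outer boundary of $Q_m$ is not identified. The result is $V_m$; it is also regarded as a graph whose vertices are the cells, two cells being adjacent when they share a unit edge after identification. Infinite magic carpet. $V_{m+1}$ consists of eight copies of $V_m$ around a central vacant square of side $3^m$. For each $m$ choose one of the eight embeddings $V_m\subseteq V_{m+1}$; $IMC$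 is the union of $V_0\subseteq V_1\subseteq V_2\subseteq\cdots$. The choices are assumed generic, so that there is no outer boundary (the outer squares exhaust the plane); thus $IMC$ is an infinite 4-regular graph on its cells. Distance. $d(x,y)$ is the length (number of steps) of a shortest path of successively adjacent cells from $x$ to $y$, and $B(x,r)=\{y : y \text{ is a cell of } IMC,\ d(x,y)<r\}$; $\#$ denotes cardinality. *)

theory Defs
  imports "HOL-Analysis.Analysis"
begin

text \<open>
  All complexes live in the plane, modelled as \<open>real \<times> real\<close>. The unit square
  \<open>[a,a+1] \<times> [b,b+1]\<close> is represented by its lower left corner \<open>(a, b) :: int \<times> int\<close>.
\<close>

definition square :: "int \<Rightarrow> int \<Rightarrow> int \<Rightarrow> (real \<times> real) set" where
  "square p q s = {real_of_int p .. real_of_int (p + s)} \<times> {real_of_int q .. real_of_int (q + s)}"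

definition digit3 :: "nat \<Rightarrow> int \<Rightarrow> int" where
  "digit3 j a = (a div 3 ^ j) mod 3"

definition V_cells :: "nat \<Rightarrow> (int \<times> int) set" where
  "V_cells m = {(a, b). 0 \<le> a \<and> a < 3 ^ m \<and> 0 \<le> b \<and> b < 3 ^ m \<and>
                        (\<forall>j<m. (digit3 j a, digit3 j b) \<noteq> (1, 1))}"

text \<open>
  \<open>vacant m j p q\<close>: the square of side \<open>3 ^ j\<close> with lower left corner \<open>(p, q)\<close> is a vacant
  square of \<open>V\<^sub>m\<close>. The corner of the surrounding block of side \<open>3 ^ (j + 1)\<close> is
  \<open>(u * 3 ^ (j + 1), v * 3 ^ (j + 1))\<close>. The definition recurses from large squares to small ones.
\<close>

function (sequential) vacant :: "nat \<Rightarrow> nat \<Rightarrow> int \<Rightarrow> int \<Rightarrow> bool" where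
  "vacant m j p q \<longleftrightarrow>
     j < m \<and>
     (\<exists>u v. p = u * 3 ^ (j + 1) + 3 ^ j \<and> q = v * 3 ^ (j + 1) + 3 ^ j \<and>
        square (u * 3 ^ (j + 1)) (v * 3 ^ (j + 1)) (3 ^ (j + 1)) \<subseteq> square 0 0 (3 ^ m) \<and>
        \<not> (\<exists>i\<in>{j<..<m}. \<exists>p' q'. vacant m i p' q' \<and>
             square (u * 3 ^ (j + 1)) (v * 3 ^ (j + 1)) (3 ^ (j + 1)) \<subseteq> square p' q' (3 ^ i)))"
  by pat_completeness auto
termination
  by (relation "Wellfounded.measure (\<lambda>(m, j, p, q). m - j)") auto

declare vacant.simps [simp del]

text \<open>
  The identification types: \<open>Klein_LR\<close> reverses the left/right pair of sides of every vacant square,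
  \<open>Klein_BT\<close> reverses the bottom/top pair.
\<close>

datatype identification = Torus | Klein_LR | Klein_BT

inductive glue :: "identification \<Rightarrow> nat \<Rightarrow> real \<times> real \<Rightarrow> real \<times> real \<Rightarrow> bool"
  for \<tau> :: identification and m :: nat where
  left_right:
    "\<lbrakk>vacant m j p q; 0 \<le> t; t \<le> 3 ^ j\<rbrakk> \<Longrightarrow>
     glue \<tau> m (real_of_int p, real_of_int q + t)
              (real_of_int p + 3 ^ j, real_of_int q + (if \<tau> = Klein_LR then 3 ^ j - t else t))"
| bottom_top:
    "\<lbrakk>vacant m j p q; 0 \<le> t; t \<le> 3 ^ j\<rbrakk> \<Longrightarrow>
     glue \<tau> m (real_of_int p + t, real_of_int q)
              (real_of_int p + (if \<tau> = Klein_BT then 3 ^ j - t else t), real_of_int q + 3 ^ j)"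

definition glue_class :: "identification \<Rightarrow> nat \<Rightarrow> real \<times> real \<Rightarrow> (real \<times> real) set" where
  "glue_class \<tau> m P = {P'. equivclp (glue \<tau> m) P P'}"

definition unit_edges :: "int \<times> int \<Rightarrow> (real \<times> real) set set" where
  "unit_edges c = (case c of (a, b) \<Rightarrow>
     {{real_of_int a} \<times> {real_of_int b .. real_of_int (b + 1)},
      {real_of_int (a + 1)} \<times> {real_of_int b .. real_of_int (b + 1)},
      {real_of_int a .. real_of_int (a + 1)} \<times> {real_of_int b},
      {real_of_int a .. real_of_int (a + 1)} \<times> {real_of_int (b + 1)}})"

text \<open>Two cells are adjacent when some edges of theirs have the same image in the quotient.\<close>

definition V_adj :: "identification \<Rightarrow> nat \<Rightarrow> int \<times> int \<Rightarrow> int \<times> int \<Rightarrow> bool" where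
  "V_adj \<tau> m c c' \<longleftrightarrow>
     c \<in> V_cells m \<and> c' \<in> V_cells m \<and> c \<noteq> c' \<and>
     (\<exists>E\<in>unit_edges c. \<exists>E'\<in>unit_edges c'. glue_class \<tau> m ` E = glue_class \<tau> m ` E')"

text \<open>
  A choice sequence \<open>e\<close> selects, for each \<open>m\<close>, which of the eight copies in \<open>V\<^bsub>m+1\<^esub>\<close> is \<open>V\<^sub>m\<close>: the
  embedding is translation by \<open>3 ^ m\<close> times \<open>e m\<close>. The union is taken in the frame in which \<open>V\<^sub>0\<close> is
  the cell \<open>(0, 0)\<close>; in this frame \<open>V\<^sub>m\<close> is translated by \<open>- offset e m\<close>.
\<close>

definition copy_positions :: "(int \<times> int) set" where
  "copy_positions = {0, 1, 2} \<times> {0, 1, 2} - {(1, 1)}"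

primrec offset :: "(nat \<Rightarrow> int \<times> int) \<Rightarrow> nat \<Rightarrow> int \<times> int" where
  "offset e 0 = (0, 0)"
| "offset e (Suc m) = offset e m + (3 ^ m * fst (e m), 3 ^ m * snd (e m))"

definition outer_square :: "(nat \<Rightarrow> int \<times> int) \<Rightarrow> nat \<Rightarrow> (real \<times> real) set" where
  "outer_square e m = square (- fst (offset e m)) (- snd (offset e m)) (3 ^ m)"

definition generic_choice :: "(nat \<Rightarrow> int \<times> int) \<Rightarrow> bool" where
  "generic_choice e \<longleftrightarrow> (\<forall>m. e m \<in> copy_positions) \<and> (\<Union>m. outer_square e m) = UNIV"

definition IMC_cells :: "(nat \<Rightarrow> int \<times> int) \<Rightarrow> (int \<times> int) set" where
  "IMC_cells e = {c. \<exists>m. c + offset e m \<in> V_cells m}"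

definition IMC_adj ::
  "identification \<Rightarrow> (nat \<Rightarrow> int \<times> int) \<Rightarrow> int \<times> int \<Rightarrow> int \<times> int \<Rightarrow> bool" where
  "IMC_adj \<tau> e c c' \<longleftrightarrow> (\<exists>m. V_adj \<tau> m (c + offset e m) (c' + offset e m))"

text \<open>The distance is \<open>\<infinity>\<close> if there is no path.\<close>

definition IMC_dist ::
  "identification \<Rightarrow> (nat \<Rightarrow> int \<times> int) \<Rightarrow> int \<times> int \<Rightarrow> int \<times> int \<Rightarrow> enat" where
  "IMC_dist \<tau> e x y = Inf {enat n |n. (IMC_adj \<tau> e ^^ n) x y}"

definition IMC_ball ::
  "identification \<Rightarrow> (nat \<Rightarrow> int \<times> int) \<Rightarrow> int \<times> int \<Rightarrow> real \<Rightarrow> (int \<times> int) set" where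
  "IMC_ball \<tau> e x r = {y \<in> IMC_cells e. ereal_of_enat (IMC_dist \<tau> e x y) < ereal r}"

end

theory Submission
  imports Defs
begin

text \<open>
  A complex \<open>V\<^sub>m\<close> has \<open>8 ^ m\<close> cells, and its diameter is of the order \<open>2 ^ m\<close>: vacant squares are
  jumped over in one step, so that only two of three copies in a middle row have to be traversed.
  As \<open>8 ^ m = (2 ^ m)\<^sup>3\<close>, balls grow like \<open>r\<^sup>3\<close>. There are two things to prove.

  \<^emph>\<open>Balls are large.\<close> The diameter of \<open>V\<^sub>m\<close> is at most \<open>48 * 2 ^ m\<close> (\<open>diameter\<close>), so a ball of
  larger radius around a cell of \<open>V\<^sub>m\<close> contains all \<open>8 ^ m\<close> cells of \<open>V\<^sub>m\<close>. Crossing \<open>V\<^sub>m\<close> along its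
  middle row or its middle column takes \<open>2 ^ m - 1\<close> steps (\<open>cross_horizontally\<close>). The main point is
  that turning from the middle row into the middle column is not more expensive
  (\<open>left_to_bottom\<close>). Both middle lines are mapped to middle lines by the reflections that occur in the
  Klein bottle gluings, so all identification types are treated alike.

  \<^emph>\<open>Balls are small.\<close> Fewer than \<open>2 ^ l\<close> steps lead only to a bounded number of blocks of side
  \<open>3 ^ (l + 2)\<close> (\<open>card_V_ball_le\<close>). A staircase function \<open>flat k\<close> contracts the vacant squares of side
  less than \<open>3 ^ k\<close> and turns blocks of side \<open>3 ^ k\<close> into squares of side \<open>2 ^ k\<close>. A path that is
  short compared with \<open>2 ^ k\<close> cannot cross such a block, but it may wind around a corner. So
  the distance is considered, in flattened coordinates, from a set that contains the corner and all
  points identified with it. Four points are enough for such a set, because the boundaries of distinct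
  vacant squares are disjoint (\<open>reflect_closed_orbit\<close>). Below \<open>2 ^ k\<close>, this distance is invariant
  under the gluing (\<open>near_reflect_imp\<close>), and hence it changes by at most 2 in each step.

  Finally, every finite path in the infinite graph lies in some \<open>V\<^sub>m\<close>, which transfers both bounds.
\<close>

section \<open>Cells and vacant squares in terms of base 3 digits\<close>

lemma digit3_shift: "j < m \<Longrightarrow> digit3 j (a + 3 ^ m * i) = digit3 j a"
proof -
  assume "j < m"
  then obtain d where d: "m = j + Suc d"
    using less_iff_Suc_add by auto
  have e: "a + 3 ^ m * i = a + 3 ^ j * (3 * (3 ^ d * i))"
    by (simp add: d power_add)
  have "(a + 3 ^ m * i) div 3 ^ j = a div 3 ^ j + 3 * (3 ^ d * i)"
    unfolding e
    using div_mult_self2[of "3 ^ j" a "3 * (3 ^ d * i)"] by simp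
  then show ?thesis
    by (simp add: digit3_def)
qed

lemma digit3_top:
  assumes "0 \<le> a" "a < 3 ^ m" "0 \<le> i" "i \<le> 2"
  shows "digit3 m (a + 3 ^ m * i) = i"
proof -
  have "(a + 3 ^ m * i) div 3 ^ m = i"
    using assms by (intro int_div_pos_eq[where r = a]) auto
  then show ?thesis
    using assms(3,4) by (simp add: digit3_def)
qed

definition block_shift :: "nat \<Rightarrow> int \<times> int \<Rightarrow> int \<times> int" where
  "block_shift m d = (3 ^ m * fst d, 3 ^ m * snd d)"

lemma copy_positions_iff:
  "(i, l) \<in> copy_positions \<longleftrightarrow> 0 \<le> i \<and> i \<le> 2 \<and> 0 \<le> l \<and> l \<le> 2 \<and> \<not> (i = 1 \<and> l = 1)"
proof -
  have "k \<in> {0, 1, 2} \<longleftrightarrow> 0 \<le> k \<and> k \<le> 2" for k :: int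
    by (simp, presburger)
  then show ?thesis
    unfolding copy_positions_def by blast
qed

lemma copy_range:
  fixes a i :: int
  assumes "0 \<le> a" "a < 3 ^ m" "0 \<le> i" "i \<le> 2"
  shows "0 \<le> a + 3 ^ m * i \<and> a + 3 ^ m * i < 3 ^ Suc m"
proof -
  have "3 ^ m * i \<le> 3 ^ m * 2" "0 \<le> 3 ^ m * i"
    using assms by (auto intro: mult_left_mono)
  then show ?thesis
    unfolding power_Suc using assms by linarith
qed

lemma V_cells_copy:
  assumes "c \<in> V_cells m" "d \<in> copy_positions"
  shows "c + block_shift m d \<in> V_cells (Suc m)"
proof -
  obtain a b where c: "c = (a, b)" by fastforce
  obtain i l where d: "d = (i, l)" by fastforce
  have il: "0 \<le> i" "i \<le> 2" "0 \<le> l" "l \<le> 2" "\<not> (i = 1 \<and> l = 1)"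
    using assms(2) by (auto simp: d copy_positions_iff)
  have ab: "0 \<le> a" "a < 3 ^ m" "0 \<le> b" "b < 3 ^ m"
    and dig: "\<forall>j<m. (digit3 j a, digit3 j b) \<noteq> (1, 1)"
    using assms(1) by (auto simp: c V_cells_def)
  have "(digit3 j (a + 3 ^ m * i), digit3 j (b + 3 ^ m * l)) \<noteq> (1, 1)" if "j < Suc m" for j
  proof (cases "j = m")
    case True
    then show ?thesis using il ab by (simp add: digit3_top)
  next
    case False
    then have "j < m" using that by simp
    then show ?thesis using dig by (simp add: digit3_shift)
  qed
  moreover have "0 \<le> a + 3 ^ m * i \<and> a + 3 ^ m * i < 3 ^ Suc m"
    "0 \<le> b + 3 ^ m * l \<and> b + 3 ^ m * l < 3 ^ Suc m"
    using copy_range il ab by blast+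
  ultimately show ?thesis
    by (simp add: c d block_shift_def V_cells_def)
qed

lemma V_cells_SucE:
  assumes "c \<in> V_cells (Suc m)"
  obtains c' d where "c' \<in> V_cells m" "d \<in> copy_positions" "c = c' + block_shift m d"
proof -
  obtain a b where c: "c = (a, b)" by fastforce
  have ab: "0 \<le> a" "a < 3 ^ Suc m" "0 \<le> b" "b < 3 ^ Suc m"
    and dig: "\<And>j. j < Suc m \<Longrightarrow> (digit3 j a, digit3 j b) \<noteq> (1, 1)"
    using assms by (auto simp: c V_cells_def)
  define a' b' i l where "a' = a mod 3 ^ m" "b' = b mod 3 ^ m" "i = a div 3 ^ m" "l = b div 3 ^ m"
  have a: "a = a' + 3 ^ m * i" "b = b' + 3 ^ m * l"
    by (auto simp: a'_b'_i_l_def)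
  have r: "0 \<le> a'" "a' < 3 ^ m" "0 \<le> b'" "b' < 3 ^ m"
    by (auto simp: a'_b'_i_l_def)
  have "0 \<le> i" "0 \<le> l"
    using ab by (auto simp: a'_b'_i_l_def pos_imp_zdiv_nonneg_iff)
  have less3: "k < 3" if "x = x' + 3 ^ m * k" "x < 3 ^ Suc m" "0 \<le> x'" for x x' k :: int
  proof (rule ccontr)
    assume "\<not> k < 3"
    then have "3 ^ m * 3 \<le> 3 ^ m * k" by (intro mult_left_mono) auto
    then show False using that unfolding power_Suc by linarith
  qed
  have "i < 3" "l < 3"
    using less3[OF a(1) ab(2) r(1)] less3[OF a(2) ab(4) r(3)] .
  have "digit3 m a = i" "digit3 m b = l"
    using digit3_top[OF r(1,2), of i] digit3_top[OF r(3,4), of l] \<open>0 \<le> i\<close> \<open>0 \<le> l\<close> \<open>i < 3\<close> \<open>l < 3\<close>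
    by (simp_all add: a)
  then have "(i, l) \<in> copy_positions"
    using dig[of m] \<open>0 \<le> i\<close> \<open>0 \<le> l\<close> \<open>i < 3\<close> \<open>l < 3\<close> by (auto simp: copy_positions_iff)
  moreover have "(a', b') \<in> V_cells m"
  proof -
    have "(digit3 j a', digit3 j b') \<noteq> (1, 1)" if "j < m" for j
      using dig[of j] that by (simp add: a digit3_shift)
    then show ?thesis
      unfolding V_cells_def using r by blast
  qed
  ultimately show ?thesis
    using that[of "(a', b')" "(i, l)"] a by (simp add: c block_shift_def)
qed

lemma card_V_cells: "finite (V_cells m) \<and> card (V_cells m) = 8 ^ m"
proof (induction m)
  case 0
  have "V_cells 0 = {(0, 0)}"
    by (auto simp: V_cells_def)
  then show ?case by simp
next
  case (Suc m)
  let ?f = "\<lambda>(c, d). c + block_shift m d"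
  have im: "V_cells (Suc m) = ?f ` (V_cells m \<times> copy_positions)"
    by (auto intro!: V_cells_copy elim!: V_cells_SucE) 
  have "inj_on ?f (V_cells m \<times> copy_positions)"
  proof (rule inj_onI)
    fix x y :: "(int \<times> int) \<times> (int \<times> int)"
    assume xy: "x \<in> V_cells m \<times> copy_positions" "y \<in> V_cells m \<times> copy_positions" "?f x = ?f y"
    obtain a b i l where x: "x = ((a, b), (i, l))" by (metis surj_pair)
    obtain a' b' i' l' where y: "y = ((a', b'), (i', l'))" by (metis surj_pair)
    have *: "(a, b) \<in> V_cells m" "(a', b') \<in> V_cells m" 
      and **: "(a, b) + block_shift m (i, l) = (a', b') + block_shift m (i', l')"
      using xy by (simp_all add: x y)
    have "(a + 3 ^ m * i) mod 3 ^ m = (a' + 3 ^ m * i') mod 3 ^ m"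
      "(b + 3 ^ m * l) mod 3 ^ m = (b' + 3 ^ m * l') mod 3 ^ m"
      using ** by (auto simp: block_shift_def)
    then have "a = a'" "b = b'"
      using * by (auto simp: V_cells_def)
    then show "x = y"
      using ** by (simp add: x y block_shift_def)
  qed
  moreover have "finite copy_positions" "card copy_positions = 8"
    unfolding copy_positions_def by auto
  ultimately show ?case
    using Suc by (simp add: im card_image card_cartesian_product)
qed

lemma square_subset_iff:
  assumes "0 \<le> s"
  shows "square p q s \<subseteq> square p' q' s' \<longleftrightarrow> p' \<le> p \<and> p + s \<le> p' + s' \<and> q' \<le> q \<and> q + s \<le> q' + s'"
proof -
  have "real_of_int p \<le> real_of_int (p + s)" "real_of_int q \<le> real_of_int (q + s)"
    using assms by auto
  then show ?thesis
    unfolding square_def times_subset_iff atLeastatMost_subset_iff atLeastatMost_empty_iff of_int_le_iff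
    by blast
qed

text \<open>
  The interval \<open>[p, p + 3 ^ j]\<close> is the middle third of a triadic interval. Both corner coordinates of
  a vacant square satisfy this condition, and it is this consequence of vacancy that the upper bound
  for balls rests on.
\<close>

definition central :: "nat \<Rightarrow> int \<Rightarrow> bool" where
  "central j p \<longleftrightarrow> p mod 3 ^ Suc j = 3 ^ j"

lemma centralE:
  assumes "central j p"
  obtains u where "p = u * 3 ^ (j + 1) + 3 ^ j"
  using assms that[of "p div 3 ^ Suc j"] by (metis central_def Suc_eq_plus1 div_mult_mod_eq)

lemma centralI: "central j (u * 3 ^ (j + 1) + 3 ^ j)"
  by (simp add: central_def add.commute[of _ "3 ^ j"] mult.commute[of u])

lemma vacant_imp_central:
  assumes "vacant m j p q"
  shows "central j p" "central j q"
  using assms centralI by (auto simp: vacant.simps[of m j p q])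

text \<open>
  A non-recursive description of the vacant squares. Unlike the recursion, it is visibly preserved by
  translation to a copy in the next complex.
\<close>

definition vacant_digits :: "nat \<Rightarrow> nat \<Rightarrow> int \<Rightarrow> int \<Rightarrow> bool" where
  "vacant_digits m j p q \<longleftrightarrow> j < m \<and> 0 \<le> p \<and> p < 3 ^ m \<and> 0 \<le> q \<and> q < 3 ^ m \<and>
     central j p \<and> central j q \<and> (\<forall>i. j < i \<and> i < m \<longrightarrow> (digit3 i p, digit3 i q) \<noteq> (1, 1))"

lemma block_in_range:
  fixes p u :: int
  assumes "j < m" "p = u * 3 ^ (j + 1) + 3 ^ j" "0 \<le> p" "p < 3 ^ m"
  shows "0 \<le> u * 3 ^ (j + 1)" "u * 3 ^ (j + 1) + 3 ^ (j + 1) \<le> 3 ^ m"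
proof -
  let ?B = "3 ^ (j + 1) :: int"
  have jB: "(3::int) ^ j < ?B" "0 < (3::int) ^ j" by simp_all
  have "0 \<le> u"
  proof (rule ccontr)
    assume "\<not> 0 \<le> u"
    then have "u * ?B \<le> (-1) * ?B" by (intro mult_right_mono) auto
    then show False using assms jB by linarith
  qed
  then show "0 \<le> u * ?B" by simp
  obtain d where "m = (j + 1) + d"
    using assms(1) by (metis Suc_eq_plus1 less_eqE Suc_leI)
  then have m: "(3::int) ^ m = 3 ^ d * ?B" by (simp add: power_add)
  have "u < 3 ^ d"
  proof (rule ccontr)
    assume "\<not> u < 3 ^ d"
    then have "3 ^ d * ?B \<le> u * ?B" by (intro mult_right_mono) auto
    then show False using assms jB m by linarith
  qed
  then have "(u + 1) * ?B \<le> 3 ^ d * ?B" by (intro mult_right_mono) auto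
  then show "u * ?B + ?B \<le> 3 ^ m" by (simp only: m distrib_right mult_1)
qed

lemma digit3_in_central:
  assumes "central i p'" "p' \<le> p" "p < p' + 3 ^ i"
  shows "digit3 i p = 1"
proof -
  obtain u where u: "p' = u * 3 ^ (i + 1) + 3 ^ i"
    using assms(1) by (rule centralE)
  have "p div 3 ^ i = 3 * u + 1"
    using assms(2,3) by (intro int_div_pos_eq[where r = "p - p'"]) (auto simp: u algebra_simps)
  then show ?thesis by (simp add: digit3_def)
qed

text \<open>
  A vacant square of larger side \<open>3 ^ i\<close> containing the surrounding block would force the digits of
  \<open>p\<close> and \<open>q\<close> at position \<open>i\<close> to be 1.
\<close>

lemma vacant_if_digits:
  assumes "vacant_digits m j p q"
  shows "vacant m j p q"
proof -
  have j: "j < m" and r: "0 \<le> p" "p < 3 ^ m" "0 \<le> q" "q < 3 ^ m"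
    and cen: "central j p" "central j q"
    and dig: "\<And>i. j < i \<Longrightarrow> i < m \<Longrightarrow> (digit3 i p, digit3 i q) \<noteq> (1, 1)"
    using assms by (auto simp: vacant_digits_def)
  obtain u v where u: "p = u * 3 ^ (j + 1) + 3 ^ j" and v: "q = v * 3 ^ (j + 1) + 3 ^ j"
    using cen by (metis centralE)
  let ?B = "3 ^ (j + 1) :: int"
  have B: "(0::int) < 3 ^ j" "?B = 3 * 3 ^ j" by simp_all
  have "square (u * ?B) (v * ?B) ?B \<subseteq> square 0 0 (3 ^ m)"
    using block_in_range[OF j u r(1,2)] block_in_range[OF j v r(3,4)]
    by (subst square_subset_iff) auto
  moreover have False
    if i: "i \<in> {j<..<m}" and vac: "vacant m i p' q'"
      and sub: "square (u * ?B) (v * ?B) ?B \<subseteq> square p' q' (3 ^ i)" for i p' q'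
  proof -
    have "p' \<le> u * ?B \<and> u * ?B + ?B \<le> p' + 3 ^ i \<and> q' \<le> v * ?B \<and> v * ?B + ?B \<le> q' + 3 ^ i"
      using sub by (subst (asm) square_subset_iff) auto
    then have "p' \<le> p" "p < p' + 3 ^ i" "q' \<le> q" "q < q' + 3 ^ i"
      using B unfolding u v by linarith+
    then have "digit3 i p = 1" "digit3 i q = 1"
      using digit3_in_central vacant_imp_central[OF vac] by blast+
    then show False using dig[of i] i by auto
  qed
  ultimately show ?thesis
    unfolding vacant.simps[of m j p q] using j u v by blast
qed

lemma round_down_central:
  assumes "digit3 i p = 1"
  shows "central i (3 ^ i * (p div 3 ^ i))"
proof -
  have "p div 3 ^ i = 3 * (p div 3 ^ i div 3) + 1"
    using assms mult_div_mod_eq[of 3 "p div 3 ^ i"] by (simp only: digit3_def)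
  then have "3 ^ i * (p div 3 ^ i) = (p div 3 ^ i div 3) * 3 ^ (i + 1) + 3 ^ i"
    by (metis (no_types, lifting) distrib_left mult.assoc mult.commute mult.right_neutral
        power_Suc2 semigroup_mult_class.mult.assoc Suc_eq_plus1)
  then show ?thesis using centralI by metis
qed

lemma digit3_round_down:
  assumes "i < k"
  shows "digit3 k (3 ^ i * (p div 3 ^ i)) = digit3 k p"
proof -
  obtain d where k: "k = i + d" using assms by (metis less_imp_add_positive)
  show ?thesis
    by (simp add: digit3_def k power_add zdiv_zmult2_eq)
qed

text \<open>
  Conversely, a pair of digits 1 at a higher position yields a larger vacant square around the block,
  provided that the highest such position is taken: the square found there satisfies the
  digit description and so is vacant by the previous lemma.
\<close>

lemma vacant_imp_digits:
  assumes "vacant m j p q"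
  shows "vacant_digits m j p q"
proof -
  let ?B = "3 ^ (j + 1) :: int"
  have B: "(0::int) < 3 ^ j" "?B = 3 * 3 ^ j" by simp_all
  obtain u v where j: "j < m" and u: "p = u * ?B + 3 ^ j" and v: "q = v * ?B + 3 ^ j"
    and sub: "square (u * ?B) (v * ?B) ?B \<subseteq> square 0 0 (3 ^ m)"
    and max: "\<And>i p' q'. i \<in> {j<..<m} \<Longrightarrow> vacant m i p' q' \<Longrightarrow>
        \<not> square (u * ?B) (v * ?B) ?B \<subseteq> square p' q' (3 ^ i)"
    using assms unfolding vacant.simps[of m j p q] by blast
  have r: "0 \<le> p" "p < 3 ^ m" "0 \<le> q" "q < 3 ^ m"
    using sub B unfolding u v by (simp_all only: square_subset_iff) linarith+
  let ?D = "{i. j < i \<and> i < m \<and> (digit3 i p, digit3 i q) = (1, 1)}"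
  have "?D = {}"
  proof (rule ccontr)
    assume ne: "?D \<noteq> {}"
    have fin: "finite ?D" by (rule finite_subset[of _ "{..<m}"]) auto
    define i where "i = Max ?D"
    have i: "j < i" "i < m" "digit3 i p = 1" "digit3 i q = 1"
      using Max_in[OF fin ne] by (auto simp: i_def)
    have above: "(digit3 k p, digit3 k q) \<noteq> (1, 1)" if "i < k" "k < m" for k
    proof
      assume "(digit3 k p, digit3 k q) = (1, 1)"
      then have "k \<in> ?D" using that i by auto
      then have "k \<le> i" unfolding i_def using fin by (rule Max_ge[rotated])
      then show False using that by simp
    qed
    define p' q' where "p' = 3 ^ i * (p div 3 ^ i)" and "q' = 3 ^ i * (q div 3 ^ i)"
    have rd: "x - 3 ^ i < 3 ^ i * (x div 3 ^ i) \<and> 3 ^ i * (x div 3 ^ i) \<le> x" for x :: int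
      by (smt (verit) mult_div_mod_eq pos_mod_bound pos_mod_sign zero_less_power)
    have nn: "0 \<le> p'" "0 \<le> q'"
      using r by (auto simp: p'_def q'_def pos_imp_zdiv_nonneg_iff)
    have "vacant_digits m i p' q'"
      unfolding vacant_digits_def
      using i r nn rd[of p] rd[of q] above
      by (auto simp: p'_def q'_def round_down_central digit3_round_down)
    then have "vacant m i p' q'" by (rule vacant_if_digits)
    moreover have "3 ^ i * (x div 3 ^ i) \<le> w * ?B \<and> w * ?B + ?B \<le> 3 ^ i * (x div 3 ^ i) + 3 ^ i"
      if "x = w * ?B + 3 ^ j" for x w :: int
    proof -
      obtain d where "i = (j + 1) + d"
        using i(1) by (metis Suc_eq_plus1 less_eqE Suc_leI)
      then have ii: "(3::int) ^ i = ?B * 3 ^ d" by (simp add: power_add)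
      have "x div ?B = w"
        using that B by (intro int_div_pos_eq[where r = "3 ^ j"]) (auto simp: mult.commute)
      then have xd: "x div 3 ^ i = w div 3 ^ d"
        unfolding ii by (simp add: zdiv_zmult2_eq)
      have "3 ^ d * (w div 3 ^ d) \<le> w" "w + 1 \<le> 3 ^ d * (w div 3 ^ d) + 3 ^ d"
        by (smt (verit) mult_div_mod_eq pos_mod_bound pos_mod_sign zero_less_power)+
      then have "?B * (3 ^ d * (w div 3 ^ d)) \<le> ?B * w" "?B * (w + 1) \<le> ?B * (3 ^ d * (w div 3 ^ d) + 3 ^ d)"
        by (auto intro!: mult_left_mono)
      then show ?thesis unfolding xd unfolding ii
        by (simp add: algebra_simps)
    qed
    then have "square (u * ?B) (v * ?B) ?B \<subseteq> square p' q' (3 ^ i)"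
      unfolding p'_def q'_def using u v by (subst square_subset_iff) auto
    ultimately show False using max[of i p' q'] i by auto
  qed
  then show ?thesis
    unfolding vacant_digits_def using j r u v centralI by blast
qed

lemma central_copy: "central j p \<Longrightarrow> j < m \<Longrightarrow> central j (p + 3 ^ m * i)"
proof -
  assume "j < m" "central j p"
  moreover obtain d where "m = Suc j + d"
    using \<open>j < m\<close> by (metis less_eqE Suc_leI)
  then have "p + 3 ^ m * i = p + 3 ^ Suc j * (3 ^ d * i)"
    by (simp add: power_add)
  ultimately show ?thesis
    unfolding central_def by (metis mod_mult_self2)
qed

lemma vacant_copy:
  assumes "vacant m j p q" "(i, l) \<in> copy_positions"
  shows "vacant (Suc m) j (p + 3 ^ m * i) (q + 3 ^ m * l)"
proof -
  have v: "vacant_digits m j p q" using assms(1) by (rule vacant_imp_digits)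
  have il: "0 \<le> i" "i \<le> 2" "0 \<le> l" "l \<le> 2" "\<not> (i = 1 \<and> l = 1)"
    using assms(2) by (auto simp: copy_positions_iff)
  have "(digit3 k (p + 3 ^ m * i), digit3 k (q + 3 ^ m * l)) \<noteq> (1, 1)" if "j < k" "k < Suc m" for k
  proof (cases "k = m")
    case True
    then show ?thesis using il v by (simp add: digit3_top vacant_digits_def)
  next
    case False
    then have "k < m" using that by simp
    then show ?thesis using v that by (simp add: digit3_shift vacant_digits_def)
  qed
  moreover have "0 \<le> p + 3 ^ m * i \<and> p + 3 ^ m * i < 3 ^ Suc m"
    "0 \<le> q + 3 ^ m * l \<and> q + 3 ^ m * l < 3 ^ Suc m"
    using copy_range[of p m i] copy_range[of q m l] il v by (auto simp: vacant_digits_def)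
  ultimately have "vacant_digits (Suc m) j (p + 3 ^ m * i) (q + 3 ^ m * l)"
    using v by (auto simp: vacant_digits_def central_copy)
  then show ?thesis by (rule vacant_if_digits)
qed

lemma vacant_centre: "vacant (Suc m) m (3 ^ m) (3 ^ m)"
  by (rule vacant_if_digits) (auto simp: vacant_digits_def central_def)

section \<open>Adjacency of cells and the embedding of a complex into the next one\<close>

lemma glue_class_eq_iff: "glue_class \<tau> m P = glue_class \<tau> m P' \<longleftrightarrow> equivclp (glue \<tau> m) P P'"
proof
  assume "glue_class \<tau> m P = glue_class \<tau> m P'"
  then show "equivclp (glue \<tau> m) P P'"
    unfolding glue_class_def by (metis equivclp_refl mem_Collect_eq)
next
  assume "equivclp (glue \<tau> m) P P'"
  then show "glue_class \<tau> m P = glue_class \<tau> m P'"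
    unfolding glue_class_def by (blast intro: equivclp_trans equivclp_sym)
qed

text \<open>
  The pointwise form serves both bounds: edges are shown to be glued point by point, and from a given
  adjacency one pair of equivalent points is picked.
\<close>

lemma glue_class_image_eq_iff:
  "glue_class \<tau> m ` E = glue_class \<tau> m ` E' \<longleftrightarrow>
     (\<forall>P\<in>E. \<exists>P'\<in>E'. equivclp (glue \<tau> m) P P') \<and> (\<forall>P'\<in>E'. \<exists>P\<in>E. equivclp (glue \<tau> m) P P')"
proof -
  have "glue_class \<tau> m ` E = glue_class \<tau> m ` E' \<longleftrightarrow>
    (\<forall>P\<in>E. \<exists>P'\<in>E'. glue_class \<tau> m P = glue_class \<tau> m P') \<and>
    (\<forall>P'\<in>E'. \<exists>P\<in>E. glue_class \<tau> m P = glue_class \<tau> m P')"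
    unfolding set_eq_subset image_subset_iff image_iff by metis
  then show ?thesis
    by (simp only: glue_class_eq_iff)
qed

definition translate :: "int \<times> int \<Rightarrow> real \<times> real \<Rightarrow> real \<times> real" where
  "translate d P = (fst P + real_of_int (fst d), snd P + real_of_int (snd d))"

lemma glue_copy:
  assumes "glue \<tau> m P P'" "d \<in> copy_positions"
  shows "glue \<tau> (Suc m) (translate (block_shift m d) P) (translate (block_shift m d) P')"
  using assms(1)
proof cases
  case (left_right j p q t)
  have "vacant (Suc m) j (p + 3 ^ m * fst d) (q + 3 ^ m * snd d)"
    using vacant_copy[OF left_right(3), of "fst d" "snd d"] assms(2) by simp
  from glue.left_right[OF this left_right(4,5), of \<tau>] show ?thesis
    by (auto simp: left_right(1,2) translate_def block_shift_def algebra_simps)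
next
  case (bottom_top j p q t)
  have "vacant (Suc m) j (p + 3 ^ m * fst d) (q + 3 ^ m * snd d)"
    using vacant_copy[OF bottom_top(3), of "fst d" "snd d"] assms(2) by simp
  from glue.bottom_top[OF this bottom_top(4,5), of \<tau>] show ?thesis
    by (auto simp: bottom_top(1,2) translate_def block_shift_def algebra_simps)
qed

lemma equivclp_glue_copy:
  assumes "equivclp (glue \<tau> m) P P'" "d \<in> copy_positions"
  shows "equivclp (glue \<tau> (Suc m)) (translate (block_shift m d) P) (translate (block_shift m d) P')"
  using assms(1)
proof (induction rule: equivclp_induct)
  case base
  then show ?case by simp
next
  case (step y z)
  then have "equivclp (glue \<tau> (Suc m)) (translate (block_shift m d) y) (translate (block_shift m d) z)"
    using glue_copy[OF _ assms(2)] by (blast intro: r_into_equivclp equivclp_sym)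
  then show ?case
    using step.IH by (rule equivclp_trans[rotated])
qed

lemma translate_Times:
  "translate d ` (A \<times> B) =
     (\<lambda>x. x + real_of_int (fst d)) ` A \<times> (\<lambda>y. y + real_of_int (snd d)) ` B"
  by (auto simp: translate_def image_iff)

lemma unit_edges_translate:
  assumes "E \<in> unit_edges c"
  shows "translate d ` E \<in> unit_edges (c + d)"
proof -
  obtain a b i l where [simp]: "c = (a, b)" "d = (i, l)" by fastforce
  show ?thesis
    using assms unfolding unit_edges_def
    by (simp, elim disjE) (simp_all add: translate_Times add_ac)
qed

lemma V_adj_copy:
  assumes "V_adj \<tau> m c c'" "d \<in> copy_positions"
  shows "V_adj \<tau> (Suc m) (c + block_shift m d) (c' + block_shift m d)"
proof -
  let ?T = "translate (block_shift m d)"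
  obtain E E' where c: "c \<in> V_cells m" "c' \<in> V_cells m" "c \<noteq> c'"
    and E: "E \<in> unit_edges c" "E' \<in> unit_edges c'"
    and eq: "glue_class \<tau> m ` E = glue_class \<tau> m ` E'"
    using assms(1) unfolding V_adj_def by blast
  have "glue_class \<tau> (Suc m) ` ?T ` E = glue_class \<tau> (Suc m) ` ?T ` E'"
    using eq equivclp_glue_copy[OF _ assms(2)]
    unfolding glue_class_image_eq_iff bex_simps ball_simps by blast
  moreover have "?T ` E \<in> unit_edges (c + block_shift m d)" "?T ` E' \<in> unit_edges (c' + block_shift m d)"
    using E by (auto intro: unit_edges_translate)
  ultimately show ?thesis
    unfolding V_adj_def using c V_cells_copy[OF _ assms(2)] by (simp only: add_right_cancel) blast
qed

lemma V_adj_sym: "V_adj \<tau> m c c' \<Longrightarrow> V_adj \<tau> m c' c"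
  unfolding V_adj_def by metis

lemma V_adj_right:
  assumes "(a, b) \<in> V_cells m" "(a + 1, b) \<in> V_cells m"
  shows "V_adj \<tau> m (a, b) (a + 1, b)"
proof -
  let ?E = "{real_of_int (a + 1)} \<times> {real_of_int b .. real_of_int (b + 1)}"
  have "?E \<in> unit_edges (a, b)" "?E \<in> unit_edges (a + 1, b)"
    by (auto simp: unit_edges_def)
  then show ?thesis using assms unfolding V_adj_def by auto
qed

lemma V_adj_up:
  assumes "(a, b) \<in> V_cells m" "(a, b + 1) \<in> V_cells m"
  shows "V_adj \<tau> m (a, b) (a, b + 1)"
proof -
  let ?E = "{real_of_int a .. real_of_int (a + 1)} \<times> {real_of_int (b + 1)}"
  have "?E \<in> unit_edges (a, b)" "?E \<in> unit_edges (a, b + 1)"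
    by (auto simp: unit_edges_def)
  then show ?thesis using assms unfolding V_adj_def by auto
qed

section \<open>The middle cells of the four sides\<close>

definition mid :: "nat \<Rightarrow> int" where
  "mid m = (3 ^ m - 1) div 2"

lemma two_mid: "2 * mid m + 1 = 3 ^ m"
proof -
  have "even ((3::int) ^ m - 1)" by simp
  then have "2 * ((3 ^ m - 1) div 2) = (3::int) ^ m - 1" by (rule dvd_mult_div_cancel)
  then show ?thesis unfolding mid_def by simp
qed

lemma mid_Suc: "mid (Suc m) = mid m + 3 ^ m"
  using two_mid[of m] two_mid[of "Suc m"] by simp

definition left_mid :: "nat \<Rightarrow> int \<times> int" where "left_mid m = (0, mid m)"
definition right_mid :: "nat \<Rightarrow> int \<times> int" where "right_mid m = (3 ^ m - 1, mid m)"
definition bottom_mid :: "nat \<Rightarrow> int \<times> int" where "bottom_mid m = (mid m, 0)"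
definition top_mid :: "nat \<Rightarrow> int \<times> int" where "top_mid m = (mid m, 3 ^ m - 1)"

lemmas side_mid_defs = left_mid_def right_mid_def bottom_mid_def top_mid_def

lemma side_mid_Suc:
  "left_mid (Suc m) = left_mid m + block_shift m (0, 1)"
  "right_mid (Suc m) = right_mid m + block_shift m (2, 1)"
  "bottom_mid (Suc m) = bottom_mid m + block_shift m (1, 0)"
  "top_mid (Suc m) = top_mid m + block_shift m (1, 2)"
  by (simp_all add: side_mid_defs block_shift_def mid_Suc)

lemma side_mid_in_V_cells:
  "left_mid m \<in> V_cells m" "right_mid m \<in> V_cells m"
  "bottom_mid m \<in> V_cells m" "top_mid m \<in> V_cells m"
proof (induction m)
  case 0
  {
    case 1 then show ?case by (simp add: side_mid_defs V_cells_def mid_def)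
  next
    case 2 then show ?case by (simp add: side_mid_defs V_cells_def mid_def)
  next
    case 3 then show ?case by (simp add: side_mid_defs V_cells_def mid_def)
  next
    case 4 then show ?case by (simp add: side_mid_defs V_cells_def mid_def)
  }
next
  case (Suc m)
  {
    case 1 then show ?case using Suc by (simp add: side_mid_Suc V_cells_copy copy_positions_iff)
  next
    case 2 then show ?case using Suc by (simp add: side_mid_Suc V_cells_copy copy_positions_iff)
  next
    case 3 then show ?case using Suc by (simp add: side_mid_Suc V_cells_copy copy_positions_iff)
  next
    case 4 then show ?case using Suc by (simp add: side_mid_Suc V_cells_copy copy_positions_iff)
  }
qed

lemma side_mid_step_right:
  assumes "(i, l) \<in> copy_positions" "(i + 1, l) \<in> copy_positions"
  shows "V_adj \<tau> (Suc m) (right_mid m + block_shift m (i, l)) (left_mid m + block_shift m (i + 1, l))"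
proof -
  have "left_mid m + block_shift m (i + 1, l) = (3 ^ m - 1 + 3 ^ m * i + 1, mid m + 3 ^ m * l)"
    "right_mid m + block_shift m (i, l) = (3 ^ m - 1 + 3 ^ m * i, mid m + 3 ^ m * l)"
    by (simp_all add: side_mid_defs block_shift_def algebra_simps)
  then show ?thesis
    using V_cells_copy[OF side_mid_in_V_cells(1) assms(2), of m]
      V_cells_copy[OF side_mid_in_V_cells(2) assms(1), of m] V_adj_right by metis
qed

lemma side_mid_step_up:
  assumes "(i, l) \<in> copy_positions" "(i, l + 1) \<in> copy_positions"
  shows "V_adj \<tau> (Suc m) (top_mid m + block_shift m (i, l)) (bottom_mid m + block_shift m (i, l + 1))"
proof -
  have "bottom_mid m + block_shift m (i, l + 1) = (mid m + 3 ^ m * i, 3 ^ m - 1 + 3 ^ m * l + 1)"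
    "top_mid m + block_shift m (i, l) = (mid m + 3 ^ m * i, 3 ^ m - 1 + 3 ^ m * l)"
    by (simp_all add: side_mid_defs block_shift_def algebra_simps)
  then show ?thesis
    using V_cells_copy[OF side_mid_in_V_cells(3) assms(2), of m]
      V_cells_copy[OF side_mid_in_V_cells(4) assms(1), of m] V_adj_up by metis
qed

text \<open>
  The step across the central vacant square at half height. For the Klein bottle with left and right
  sides reversed the edge is reflected, but the middle edge is mapped to itself by the reflection
  because the side has odd length; so the same two cells are adjacent for all three types.
\<close>

lemma jump_right:
  "V_adj \<tau> (Suc m) (right_mid m + block_shift m (0, 1)) (left_mid m + block_shift m (2, 1))"
proof -
  let ?N = "3 ^ m :: int" and ?h = "mid m"
  let ?r = "right_mid m + block_shift m (0, 1)" and ?l = "left_mid m + block_shift m (2, 1)"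
  have coords: "?r = (?N - 1, ?N + ?h)" "?l = (2 * ?N, ?N + ?h)"
    by (simp_all add: side_mid_defs block_shift_def)
  let ?Y = "{real_of_int (?N + ?h) .. real_of_int (?N + ?h + 1)}"
  let ?E = "{real_of_int ?N} \<times> ?Y" and ?E' = "{real_of_int (2 * ?N)} \<times> ?Y"
  have "2 * real_of_int ?h + 1 = real_of_int ?N"
    using two_mid[of m] by (metis of_int_1 of_int_add of_int_mult of_int_numeral)
  then have N: "2 * real_of_int ?h + 1 = 3 ^ m" by simp
  have h: "0 \<le> ?h" using two_mid[of m] by (smt (verit) zero_less_power)
  define \<sigma> :: "real \<Rightarrow> real" where "\<sigma> t = (if \<tau> = Klein_LR then 3 ^ m - t else t)" for t
  have \<sigma>: "\<sigma> (\<sigma> t) = t" "t \<in> {real_of_int ?h..real_of_int ?h + 1} \<Longrightarrow> \<sigma> t \<in> {real_of_int ?h..real_of_int ?h + 1}" for t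
    using N by (auto simp: \<sigma>_def)
  have eq: "equivclp (glue \<tau> (Suc m)) (3 ^ m, 3 ^ m + t) (2 * 3 ^ m, 3 ^ m + \<sigma> t)"
    if "t \<in> {real_of_int ?h..real_of_int ?h + 1}" for t
    using glue.left_right[OF vacant_centre, of t m \<tau>] that N h
    by (intro r_into_equivclp) (simp add: \<sigma>_def)
  have "glue_class \<tau> (Suc m) ` ?E = glue_class \<tau> (Suc m) ` ?E'"
    unfolding glue_class_image_eq_iff
  proof (intro conjI ballI)
    fix P assume "P \<in> ?E"
    then obtain t where t: "t \<in> {real_of_int ?h..real_of_int ?h + 1}" "P = (3 ^ m, 3 ^ m + t)"
      by (auto intro!: that[of "snd P - 3 ^ m"])
    then show "\<exists>P'\<in>?E'. equivclp (glue \<tau> (Suc m)) P P'"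
      using eq[OF t(1)] \<sigma>(2)[OF t(1)] by (intro bexI[of _ "(2 * 3 ^ m, 3 ^ m + \<sigma> t)"]) auto
  next
    fix P assume "P \<in> ?E'"
    then obtain t where t: "t \<in> {real_of_int ?h..real_of_int ?h + 1}" "P = (2 * 3 ^ m, 3 ^ m + t)"
      by (auto intro!: that[of "snd P - 3 ^ m"])
    then show "\<exists>P'\<in>?E. equivclp (glue \<tau> (Suc m)) P' P"
      using eq[OF \<sigma>(2)[OF t(1)]] \<sigma>(2)[OF t(1)] \<sigma>(1)[of t]
      by (intro bexI[of _ "(3 ^ m, 3 ^ m + \<sigma> t)"]) auto
  qed
  moreover have "?E \<in> unit_edges ?r" "?E' \<in> unit_edges ?l"
    unfolding coords by (auto simp: unit_edges_def)
  moreover have "?r \<in> V_cells (Suc m)" "?l \<in> V_cells (Suc m)"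
    by (simp_all add: V_cells_copy side_mid_in_V_cells copy_positions_iff)
  moreover have "?r \<noteq> ?l"
    unfolding coords by (smt (verit) prod.inject zero_less_power)
  ultimately show ?thesis
    unfolding V_adj_def by blast
qed

lemma jump_up:
  "V_adj \<tau> (Suc m) (top_mid m + block_shift m (1, 0)) (bottom_mid m + block_shift m (1, 2))"
proof -
  let ?N = "3 ^ m :: int" and ?h = "mid m"
  let ?r = "top_mid m + block_shift m (1, 0)" and ?l = "bottom_mid m + block_shift m (1, 2)"
  have coords: "?r = (?N + ?h, ?N - 1)" "?l = (?N + ?h, 2 * ?N)"
    by (simp_all add: side_mid_defs block_shift_def)
  let ?X = "{real_of_int (?N + ?h) .. real_of_int (?N + ?h + 1)}"
  let ?E = "?X \<times> {real_of_int ?N}" and ?E' = "?X \<times> {real_of_int (2 * ?N)}"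
  have "2 * real_of_int ?h + 1 = real_of_int ?N"
    using two_mid[of m] by (metis of_int_1 of_int_add of_int_mult of_int_numeral)
  then have N: "2 * real_of_int ?h + 1 = 3 ^ m" by simp
  have h: "0 \<le> ?h" using two_mid[of m] by (smt (verit) zero_less_power)
  define \<sigma> :: "real \<Rightarrow> real" where "\<sigma> t = (if \<tau> = Klein_BT then 3 ^ m - t else t)" for t
  have \<sigma>: "\<sigma> (\<sigma> t) = t" "t \<in> {real_of_int ?h..real_of_int ?h + 1} \<Longrightarrow> \<sigma> t \<in> {real_of_int ?h..real_of_int ?h + 1}" for t
    using N by (auto simp: \<sigma>_def)
  have eq: "equivclp (glue \<tau> (Suc m)) (3 ^ m + t, 3 ^ m) (3 ^ m + \<sigma> t, 2 * 3 ^ m)"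
    if "t \<in> {real_of_int ?h..real_of_int ?h + 1}" for t
    using glue.bottom_top[OF vacant_centre, of t m \<tau>] that N h
    by (intro r_into_equivclp) (simp add: \<sigma>_def)
  have "glue_class \<tau> (Suc m) ` ?E = glue_class \<tau> (Suc m) ` ?E'"
    unfolding glue_class_image_eq_iff
  proof (intro conjI ballI)
    fix P assume "P \<in> ?E"
    then obtain t where t: "t \<in> {real_of_int ?h..real_of_int ?h + 1}" "P = (3 ^ m + t, 3 ^ m)"
      by (auto intro!: that[of "fst P - 3 ^ m"])
    then show "\<exists>P'\<in>?E'. equivclp (glue \<tau> (Suc m)) P P'"
      using eq[OF t(1)] \<sigma>(2)[OF t(1)] by (intro bexI[of _ "(3 ^ m + \<sigma> t, 2 * 3 ^ m)"]) auto
  next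
    fix P assume "P \<in> ?E'"
    then obtain t where t: "t \<in> {real_of_int ?h..real_of_int ?h + 1}" "P = (3 ^ m + t, 2 * 3 ^ m)"
      by (auto intro!: that[of "fst P - 3 ^ m"])
    then show "\<exists>P'\<in>?E. equivclp (glue \<tau> (Suc m)) P' P"
      using eq[OF \<sigma>(2)[OF t(1)]] \<sigma>(2)[OF t(1)] \<sigma>(1)[of t]
      by (intro bexI[of _ "(3 ^ m + \<sigma> t, 3 ^ m)"]) auto
  qed
  moreover have "?E \<in> unit_edges ?r" "?E' \<in> unit_edges ?l"
    unfolding coords by (auto simp: unit_edges_def)
  moreover have "?r \<in> V_cells (Suc m)" "?l \<in> V_cells (Suc m)"
    by (simp_all add: V_cells_copy side_mid_in_V_cells copy_positions_iff)
  moreover have "?r \<noteq> ?l"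
    unfolding coords by (smt (verit) prod.inject zero_less_power)
  ultimately show ?thesis
    unfolding V_adj_def by blast
qed

section \<open>The diameter of a finite complex\<close>

definition joined :: "identification \<Rightarrow> nat \<Rightarrow> nat \<Rightarrow> int \<times> int \<Rightarrow> int \<times> int \<Rightarrow> bool" where
  "joined \<tau> m n c c' \<longleftrightarrow> (\<exists>k\<le>n. (V_adj \<tau> m ^^ k) c c')"

lemma joined_refl: "joined \<tau> m n c c"
  unfolding joined_def by (intro exI[of _ 0]) simp

lemma joined_adj: "V_adj \<tau> m c c' \<Longrightarrow> joined \<tau> m 1 c c'"
  unfolding joined_def by (metis One_nat_def order_refl relpowp_0_I relpowp_Suc_I)

lemma joined_trans [trans]: 
  assumes "joined \<tau> m n1 c1 c2" "joined \<tau> m n2 c2 c3"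
  shows "joined \<tau> m (n1 + n2) c1 c3"
proof -
  obtain k1 k2 where "k1 \<le> n1" "(V_adj \<tau> m ^^ k1) c1 c2" "k2 \<le> n2" "(V_adj \<tau> m ^^ k2) c2 c3"
    using assms by (auto simp: joined_def)
  then show ?thesis
    unfolding joined_def by (intro exI[of _ "k1 + k2"]) (auto simp: relpowp_add)
qed

lemma joined_sym: "joined \<tau> m n c c' \<Longrightarrow> joined \<tau> m n c' c"
proof -
  have "(V_adj \<tau> m ^^ k) c c' \<Longrightarrow> (V_adj \<tau> m ^^ k) c' c" for k c c'
  proof (induction k arbitrary: c')
    case (Suc k)
    then show ?case by (metis V_adj_sym relpowp_Suc_E relpowp_Suc_I2)
  qed auto
  then show "joined \<tau> m n c c' \<Longrightarrow> joined \<tau> m n c' c"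
    unfolding joined_def by blast
qed

lemma joined_mono: "joined \<tau> m n c c' \<Longrightarrow> n \<le> n' \<Longrightarrow> joined \<tau> m n' c c'"
  unfolding joined_def by (meson order_trans)

lemma joined_copy:
  assumes "joined \<tau> m n c c'" "d \<in> copy_positions"
  shows "joined \<tau> (Suc m) n (c + block_shift m d) (c' + block_shift m d)"
proof -
  have "(V_adj \<tau> (Suc m) ^^ k) (c + block_shift m d) (c' + block_shift m d)"
    if "(V_adj \<tau> m ^^ k) c c'" for k
    using that
  proof (induction k arbitrary: c')
    case (Suc k)
    then show ?case by (metis V_adj_copy[OF _ assms(2)] relpowp_Suc_E relpowp_Suc_I)
  qed auto
  then show ?thesis using assms(1) unfolding joined_def by blast
qed

text \<open>
  This is where the growth exponent comes from: three copies lie side by side, but the middle one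
  is vacant and is jumped over, so a crossing costs \<open>2 ^ m\<close> instead of \<open>3 ^ m\<close> steps.
\<close>

lemma cross_horizontally: "joined \<tau> m (2 ^ m - 1) (left_mid m) (right_mid m)"
proof (induction m)
  case 0
  then show ?case by (simp add: side_mid_defs joined_refl)
next
  case (Suc m)
  have "joined \<tau> (Suc m) (2 ^ m - 1) (left_mid m + block_shift m (0, 1)) (right_mid m + block_shift m (0, 1))"
    by (rule joined_copy[OF Suc]) (simp add: copy_positions_iff)
  also have "joined \<tau> (Suc m) 1 (right_mid m + block_shift m (0, 1)) (left_mid m + block_shift m (2, 1))"
    by (rule joined_adj[OF jump_right])
  also have "joined \<tau> (Suc m) (2 ^ m - 1) (left_mid m + block_shift m (2, 1)) (right_mid m + block_shift m (2, 1))"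
    by (rule joined_copy[OF Suc]) (simp add: copy_positions_iff)
  finally show ?case
    unfolding side_mid_Suc by (rule joined_mono) simp
qed

lemma cross_vertically: "joined \<tau> m (2 ^ m - 1) (bottom_mid m) (top_mid m)"
proof (induction m)
  case 0
  then show ?case by (simp add: side_mid_defs joined_refl)
next
  case (Suc m)
  have "joined \<tau> (Suc m) (2 ^ m - 1) (bottom_mid m + block_shift m (1, 0)) (top_mid m + block_shift m (1, 0))"
    by (rule joined_copy[OF Suc]) (simp add: copy_positions_iff)
  also have "joined \<tau> (Suc m) 1 (top_mid m + block_shift m (1, 0)) (bottom_mid m + block_shift m (1, 2))"
    by (rule joined_adj[OF jump_up])
  also have "joined \<tau> (Suc m) (2 ^ m - 1) (bottom_mid m + block_shift m (1, 2)) (top_mid m + block_shift m (1, 2))"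
    by (rule joined_copy[OF Suc]) (simp add: copy_positions_iff)
  finally show ?case
    unfolding side_mid_Suc by (rule joined_mono) simp
qed

lemma run_right:
  assumes "(i, l) \<in> copy_positions"
  shows "joined \<tau> (Suc m) (2 ^ m - 1) (left_mid m + block_shift m (i, l)) (right_mid m + block_shift m (i, l))"
  by (rule joined_copy[OF cross_horizontally assms])

lemma run_up:
  assumes "(i, l) \<in> copy_positions"
  shows "joined \<tau> (Suc m) (2 ^ m - 1) (bottom_mid m + block_shift m (i, l)) (top_mid m + block_shift m (i, l))"
  by (rule joined_copy[OF cross_vertically assms])

text \<open>
  For \<open>m \<ge> 1\<close> the middle row and the middle column have no common cell, since they would meet in
  the vacant centre. So a path has to turn from one to the other elsewhere. Going down one level and turning
  in a copy of the previous complex leads to \<open>T (m + 1) \<le> 3 * T m + O(2 ^ m)\<close> for the cost \<open>T\<close> of a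
  turn, which is too weak. Three turns also suffice when two levels are descended at once: view the
  complex of level \<open>m + 2\<close> as a \<open>9 \<times> 9\<close> grid of copies of level \<open>m\<close> and follow the grid positions
  \<open>(0,4), (2,4), (2,3), (2,2), (3,2), (4,2)\<close> and then \<open>(4,2), (4,0)\<close>, turning at \<open>(2,4)\<close>, \<open>(2,2)\<close> and
  \<open>(4,2)\<close>. All straight parts together cost at most \<open>10 * 2 ^ m\<close>, so
  \<open>T (m + 2) \<le> 3 * T m + 10 * 2 ^ m\<close>. As \<open>3 < 2\<^sup>2\<close>, this gives \<open>T m = O(2 ^ m)\<close>; the constant 10
  solves \<open>3 * K + 10 = 4 * K\<close>.
\<close>

lemma left_to_bottom: "joined \<tau> m (10 * 2 ^ m) (left_mid m) (bottom_mid m)"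
proof (induction m rule: less_induct)
  case (less n)
  consider "n = 0" | "n = 1" | m where "n = Suc (Suc m)"
    by (metis One_nat_def not0_implies_Suc)
  then show ?case
  proof cases
    case 1
    then show ?thesis by (simp add: side_mid_defs mid_def joined_refl)
  next
    case 2
    have "V_adj \<tau> 1 (0, 0) (0, 1)" "V_adj \<tau> 1 (0, 0) (1, 0)"
      using V_adj_up[of 0 0 1 \<tau>] V_adj_right[of 0 0 1 \<tau>] by (simp_all add: V_cells_def digit3_def)
    then have "joined \<tau> 1 (1 + 1) (0, 1) (1, 0)"
      by (meson joined_adj joined_trans V_adj_sym)
    then show ?thesis
      unfolding 2 side_mid_defs by (auto simp: mid_def intro: joined_mono)
  next
    case 3
    let ?D = "\<lambda>d. block_shift m d"
    define T where "T = 10 * (2::nat) ^ m"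
    have one: "1 \<le> (2::nat) ^ m" by simp
    have turn: "joined \<tau> (Suc m) T (left_mid m + ?D d) (bottom_mid m + ?D d)" if "d \<in> copy_positions" for d
      using joined_copy[OF _ that] less[of m] 3 by (simp add: T_def)
    \<comment> \<open>Inside the copy \<open>(0,1)\<close> of level \<open>m + 1\<close>: grid positions (0,4) to (2,4), then down to (2,3).\<close>
    have A: "joined \<tau> (Suc m) (T + 4 * 2 ^ m - 2) (left_mid (Suc m)) (bottom_mid m + ?D (2, 0))"
    proof -
      have "joined \<tau> (Suc m) (2 ^ Suc m - 1) (left_mid (Suc m)) (right_mid (Suc m))"
        by (rule cross_horizontally)
      also have "joined \<tau> (Suc m) (2 ^ m - 1) (right_mid (Suc m)) (left_mid m + ?D (2, 1))"
        unfolding side_mid_Suc by (rule joined_sym[OF run_right]) (simp add: copy_positions_iff)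
      also have "joined \<tau> (Suc m) T (left_mid m + ?D (2, 1)) (bottom_mid m + ?D (2, 1))"
        by (rule turn) (simp add: copy_positions_iff)
      also have "joined \<tau> (Suc m) 1 (bottom_mid m + ?D (2, 1)) (top_mid m + ?D (2, 0))"
        using joined_sym[OF joined_adj[OF side_mid_step_up[of 2 0 \<tau> m]]] by (simp add: copy_positions_iff)
      also have "joined \<tau> (Suc m) (2 ^ m - 1) (top_mid m + ?D (2, 0)) (bottom_mid m + ?D (2, 0))"
        by (rule joined_sym[OF run_up]) (simp add: copy_positions_iff)
      finally show ?thesis
        by (rule joined_mono) (use one in \<open>unfold power_Suc, arith\<close>)
    qed
    \<comment> \<open>Inside the copy \<open>(0,0)\<close>: the turn at grid position (2,2).\<close>
    have B: "joined \<tau> (Suc m) (T + 2 * 2 ^ m - 2) (top_mid m + ?D (2, 2)) (right_mid m + ?D (2, 2))"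
    proof -
      have "joined \<tau> (Suc m) (2 ^ m - 1) (top_mid m + ?D (2, 2)) (bottom_mid m + ?D (2, 2))"
        by (rule joined_sym[OF run_up]) (simp add: copy_positions_iff)
      also have "joined \<tau> (Suc m) T (bottom_mid m + ?D (2, 2)) (left_mid m + ?D (2, 2))"
        by (rule joined_sym[OF turn]) (simp add: copy_positions_iff)
      also have "joined \<tau> (Suc m) (2 ^ m - 1) (left_mid m + ?D (2, 2)) (right_mid m + ?D (2, 2))"
        by (intro run_right) (simp add: copy_positions_iff)
      finally show ?thesis
        by (rule joined_mono) (use one in \<open>arith\<close>)
    qed
    \<comment> \<open>Inside the copy \<open>(1,0)\<close>: grid positions (3,2) and (4,2), back up to the top side, then down the middle column.\<close>
    have C: "joined \<tau> (Suc m) (T + 4 * 2 ^ m - 2) (left_mid m + ?D (0, 2)) (bottom_mid (Suc m))"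
    proof -
      have "joined \<tau> (Suc m) (2 ^ m - 1) (left_mid m + ?D (0, 2)) (right_mid m + ?D (0, 2))"
        by (intro run_right) (simp add: copy_positions_iff)
      also have "joined \<tau> (Suc m) 1 (right_mid m + ?D (0, 2)) (left_mid m + ?D (1, 2))"
        using joined_adj[OF side_mid_step_right[of 0 2 \<tau> m]] by (simp add: copy_positions_iff)
      also have "joined \<tau> (Suc m) T (left_mid m + ?D (1, 2)) (bottom_mid m + ?D (1, 2))"
        by (rule turn) (simp add: copy_positions_iff)
      also have "joined \<tau> (Suc m) (2 ^ m - 1) (bottom_mid m + ?D (1, 2)) (top_mid (Suc m))"
        unfolding side_mid_Suc by (intro run_up) (simp add: copy_positions_iff)
      also have "joined \<tau> (Suc m) (2 ^ Suc m - 1) (top_mid (Suc m)) (bottom_mid (Suc m))"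
        by (rule joined_sym[OF cross_vertically])
      finally show ?thesis
        by (rule joined_mono) (use one in \<open>unfold power_Suc, arith\<close>)
    qed
    let ?DD = "\<lambda>d. block_shift (Suc m) d"
    have "joined \<tau> n (T + 4 * 2 ^ m - 2) (left_mid n) (bottom_mid m + ?D (2, 0) + ?DD (0, 1))"
      unfolding 3 side_mid_Suc(1)[of "Suc m"] by (rule joined_copy[OF A]) (simp add: copy_positions_iff)
    also have "joined \<tau> n 1 (bottom_mid m + ?D (2, 0) + ?DD (0, 1)) (top_mid m + ?D (2, 2) + ?DD (0, 0))"
    proof -
      have *: "bottom_mid m + ?D (2, 0) + ?DD (0, 1) = (mid m + 2 * 3 ^ m, 3 ^ Suc m - 1 + 1)"
        "top_mid m + ?D (2, 2) + ?DD (0, 0) = (mid m + 2 * 3 ^ m, 3 ^ Suc m - 1)"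
        by (simp_all add: side_mid_defs block_shift_def)
      have "bottom_mid m + ?D (2, 0) + ?DD (0, 1) \<in> V_cells n"
        "top_mid m + ?D (2, 2) + ?DD (0, 0) \<in> V_cells n"
        unfolding 3 by (intro V_cells_copy side_mid_in_V_cells; simp add: copy_positions_iff)+
      then show ?thesis
        unfolding * by - (rule joined_sym[OF joined_adj[OF V_adj_up]])
    qed
    also have "joined \<tau> n (T + 2 * 2 ^ m - 2) (top_mid m + ?D (2, 2) + ?DD (0, 0)) (right_mid m + ?D (2, 2) + ?DD (0, 0))"
      unfolding 3 by (rule joined_copy[OF B]) (simp add: copy_positions_iff)
    also have "joined \<tau> n 1 (right_mid m + ?D (2, 2) + ?DD (0, 0)) (left_mid m + ?D (0, 2) + ?DD (1, 0))"
    proof -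
      have *: "left_mid m + ?D (0, 2) + ?DD (1, 0) = (3 ^ Suc m - 1 + 1, mid m + 2 * 3 ^ m)"
        "right_mid m + ?D (2, 2) + ?DD (0, 0) = (3 ^ Suc m - 1, mid m + 2 * 3 ^ m)"
        by (simp_all add: side_mid_defs block_shift_def)
      have "left_mid m + ?D (0, 2) + ?DD (1, 0) \<in> V_cells n"
        "right_mid m + ?D (2, 2) + ?DD (0, 0) \<in> V_cells n"
        unfolding 3 by (intro V_cells_copy side_mid_in_V_cells; simp add: copy_positions_iff)+
      then show ?thesis
        unfolding * by - (rule joined_adj[OF V_adj_right])
    qed
    also have "joined \<tau> n (T + 4 * 2 ^ m - 2) (left_mid m + ?D (0, 2) + ?DD (1, 0)) (bottom_mid n)"
      unfolding 3 side_mid_Suc(3)[of "Suc m"] by (rule joined_copy[OF C]) (simp add: copy_positions_iff)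
    finally show ?thesis
      by (rule joined_mono) (use one in \<open>unfold T_def 3 power_Suc, arith\<close>)
  qed
qed

text \<open>
  The copies form a ring around the vacant centre. Each of them is reached from copy \<open>(0,1)\<close> by
  at most one vertical move, which costs two turns and one crossing, and two horizontal moves.
\<close>

lemma left_mid_of_copy:
  assumes "d \<in> copy_positions"
  shows "joined \<tau> (Suc m) (24 * 2 ^ m) (left_mid m + block_shift m d) (left_mid (Suc m))"
proof -
  let ?L = "\<lambda>d. left_mid m + block_shift m d"
  have right: "joined \<tau> (Suc m) (2 ^ m) (?L (i + 1, l)) (?L (i, l))"
    if "(i, l) \<in> copy_positions" "(i + 1, l) \<in> copy_positions" for i l
    using joined_sym[OF joined_trans[OF run_right[OF that(1)] joined_adj[OF side_mid_step_right[OF that]]]]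
    by simp
  have jump: "joined \<tau> (Suc m) (2 ^ m) (?L (2, 1)) (?L (0, 1))"
    using joined_sym[OF joined_trans[OF run_right joined_adj[OF jump_right]]] by (simp add: copy_positions_iff)
  have turn: "joined \<tau> (Suc m) (10 * 2 ^ m) (?L d) (bottom_mid m + block_shift m d)"
    if "d \<in> copy_positions" for d
    by (rule joined_copy[OF left_to_bottom that])
  have up: "joined \<tau> (Suc m) (22 * 2 ^ m) (?L (i, l)) (?L (i, l + 1))"
    if "(i, l) \<in> copy_positions" "(i, l + 1) \<in> copy_positions" for i l
  proof -
    have "joined \<tau> (Suc m) (10 * 2 ^ m) (?L (i, l)) (bottom_mid m + block_shift m (i, l))"
      by (rule turn[OF that(1)])
    also have "joined \<tau> (Suc m) (2 ^ m - 1) (bottom_mid m + block_shift m (i, l)) (top_mid m + block_shift m (i, l))"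
      by (rule run_up[OF that(1)])
    also have "joined \<tau> (Suc m) 1 (top_mid m + block_shift m (i, l)) (bottom_mid m + block_shift m (i, l + 1))"
      by (rule joined_adj[OF side_mid_step_up[OF that]])
    also have "joined \<tau> (Suc m) (10 * 2 ^ m) (bottom_mid m + block_shift m (i, l + 1)) (?L (i, l + 1))"
      by (rule joined_sym[OF turn[OF that(2)]])
    finally show ?thesis by (rule joined_mono) simp
  qed
  have P: "(i, l) \<in> copy_positions" if "(i, l) \<in> {(0,0),(1,0),(2,0),(0,1),(2,1),(0,2),(1,2),(2,2)}" for i l
    using that by (auto simp: copy_positions_iff)
  have "d \<in> {(0,0),(1,0),(2,0),(0,1),(2,1),(0,2),(1,2),(2,2)}"
    using assms by (auto simp: copy_positions_def)
  moreover have 0: "joined \<tau> (Suc m) (22 * 2 ^ m) (?L (0, l)) (?L (0, 1))" if "l \<in> {0, 1, 2}" for l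
    using that up[of 0 0] joined_sym[OF up[of 0 1]] by (auto simp: P joined_refl)
  moreover have 1: "joined \<tau> (Suc m) (23 * 2 ^ m) (?L (1, l)) (?L (0, 1))" if "l \<in> {0, 2}" for l
    using joined_trans[OF right[of 0 l] 0[of l]] that by (auto simp: P)
  moreover have 2: "joined \<tau> (Suc m) (24 * 2 ^ m) (?L (2, l)) (?L (0, 1))" if "l \<in> {0, 2}" for l
    using joined_trans[OF right[of 1 l] 1[of l]] that by (auto simp: P)
  ultimately show ?thesis
    unfolding side_mid_Suc
    using jump[THEN joined_mono, of "24 * 2 ^ m"] 0[THEN joined_mono, of _ "24 * 2 ^ m"]
      1[THEN joined_mono, of _ "24 * 2 ^ m"] 2
    by auto
qed

text \<open>
  Descending through the nested copies that contain the cell produces a geometric series.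
\<close>

lemma joined_left_mid:
  assumes "c \<in> V_cells m"
  shows "joined \<tau> m (24 * 2 ^ m) c (left_mid m)"
  using assms
proof (induction m arbitrary: c)
  case 0
  then have "c = left_mid 0" by (auto simp: V_cells_def side_mid_defs mid_def)
  then show ?case by (simp add: joined_refl)
next
  case (Suc m)
  then obtain c' d where cd: "c' \<in> V_cells m" "d \<in> copy_positions" "c = c' + block_shift m d"
    by (metis V_cells_SucE)
  have "joined \<tau> (Suc m) (24 * 2 ^ m) c (left_mid m + block_shift m d)"
    unfolding cd(3) by (rule joined_copy[OF Suc.IH[OF cd(1)] cd(2)])
  also have "joined \<tau> (Suc m) (24 * 2 ^ m) (left_mid m + block_shift m d) (left_mid (Suc m))"
    by (rule left_mid_of_copy[OF cd(2)])
  finally show ?case by simp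
qed

lemma diameter:
  assumes "c \<in> V_cells m" "c' \<in> V_cells m"
  shows "joined \<tau> m (48 * 2 ^ m) c c'"
  using joined_trans[OF joined_left_mid[OF assms(1)] joined_sym[OF joined_left_mid[OF assms(2)]]]
  by simp

section \<open>Collapsing middle thirds\<close>

text \<open>
  The monotone function of slope 0 or 1 that contracts every interval \<open>[3 u + 1, 3 u + 2]\<close> to a point,
  normalised to be odd. The multiple \<open>3 u\<close> nearest to \<open>z\<close> is the reference point.
\<close>

definition collapse :: "real \<Rightarrow> real" where
  "collapse z = 2 * of_int (round (z / 3)) + max (-1) (min 1 (z - 3 * of_int (round (z / 3))))"

lemma near_multiple_of_3: "\<exists>u::int. \<bar>z - 3 * of_int u\<bar> \<le> 3 / 2" for z :: real
  using of_int_round_abs_le[of "z / 3"] by (intro exI[of _ "round (z / 3)"]) linarith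

text \<open>
  Allowing distance 2 from the reference point, instead of the distance \<open>3 / 2\<close> to a nearest one, frees
  later proofs from the way in which rounding breaks ties.
\<close>

lemma collapse_eq:
  assumes "\<bar>z - 3 * of_int u\<bar> \<le> 2"
  shows "collapse z = 2 * of_int u + max (-1) (min 1 (z - 3 * of_int u))"
proof -
  define w where "w = round (z / 3)"
  have w: "\<bar>z - 3 * of_int w\<bar> \<le> 3 / 2"
    using of_int_round_abs_le[of "z / 3"] unfolding w_def by linarith
  have "real_of_int u < of_int w + 2" "real_of_int w < of_int u + 2"
    using w assms by linarith+
  then have "u < w + 2" "w < u + 2" by linarith+
  then consider "u = w" | "u = w + 1" | "u = w - 1" by linarith
  then show ?thesis
    using w assms unfolding collapse_def w_def[symmetric] max_def min_def
    by cases (auto split: if_splits)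
qed

lemma collapse_period: "collapse (z + 3 * of_int u) = collapse z + 2 * of_int u"
proof -
  obtain w :: int where w: "\<bar>z - 3 * of_int w\<bar> \<le> 3 / 2" using near_multiple_of_3 by blast
  have "collapse z = 2 * of_int w + max (-1) (min 1 (z - 3 * of_int w))"
    by (rule collapse_eq) (use w in linarith)
  moreover have "collapse (z + 3 * of_int u) = 2 * of_int (w + u) + max (-1) (min 1 (z + 3 * of_int u - 3 * of_int (w + u)))"
    by (rule collapse_eq) (use w in simp)
  ultimately show ?thesis by (simp add: algebra_simps)
qed

lemma collapse_minus: "collapse (- z) = - collapse z"
proof -
  obtain w :: int where w: "\<bar>z - 3 * of_int w\<bar> \<le> 3 / 2" using near_multiple_of_3 by blast
  have "collapse z = 2 * of_int w + max (-1) (min 1 (z - 3 * of_int w))"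
    by (rule collapse_eq) (use w in linarith)
  moreover have "collapse (- z) = 2 * of_int (- w) + max (-1) (min 1 (- z - 3 * of_int (- w)))"
    by (rule collapse_eq) (use w in \<open>unfold of_int_minus, linarith\<close>)
  ultimately show ?thesis by (simp add: max_def min_def)
qed

lemma collapse_middle:
  assumes "3 * of_int u + 1 \<le> z" "z \<le> 3 * of_int u + 2"
  shows "collapse z = 2 * of_int u + 1"
proof -
  have "collapse z = 2 * of_int u + max (-1) (min 1 (z - 3 * of_int u))"
    by (rule collapse_eq) (use assms in linarith)
  then show ?thesis using assms by (simp add: max_def min_def)
qed

lemma collapse_diff:
  assumes "x \<le> y"
  shows "0 \<le> collapse y - collapse x" "collapse y - collapse x \<le> y - x"
proof -
  obtain v :: int where v: "\<bar>y - 3 * of_int v\<bar> \<le> 3 / 2" using near_multiple_of_3 by blast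
  obtain w :: int where w: "\<bar>x - 3 * of_int w\<bar> \<le> 3 / 2" using near_multiple_of_3 by blast
  have cy: "collapse y = 2 * of_int v + max (-1) (min 1 (y - 3 * of_int v))"
    by (rule collapse_eq) (use v in linarith)
  have cx: "collapse x = 2 * of_int w + max (-1) (min 1 (x - 3 * of_int w))"
    by (rule collapse_eq) (use w in linarith)
  have "w = v \<or> w + 1 \<le> v \<or> v + 1 \<le> w" by linarith
  then have *: "w = v \<or> real_of_int w + 1 \<le> real_of_int v \<or> real_of_int v + 1 \<le> real_of_int w"
    by linarith
  show "0 \<le> collapse y - collapse x" "collapse y - collapse x \<le> y - x"
    unfolding cx cy using assms v w *
    by (auto simp: max_def min_def abs_le_iff)
qed

text \<open>
  A staircase function: it contracts the middle thirds of all triadic intervals of side at most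
  \<open>3 ^ k\<close>, so that a block of side \<open>3 ^ k\<close> gets side \<open>2 ^ k\<close>. Since it contracts the sides of
  all vacant squares of side less than \<open>3 ^ k\<close>, a step across such a square changes it as little as an
  ordinary step; applied to both coordinates it measures distances inside blocks of side \<open>3 ^ k\<close>.
\<close>

primrec flat :: "nat \<Rightarrow> real \<Rightarrow> real" where
  "flat 0 x = x"
| "flat (Suc k) x = 2 ^ k * collapse (flat k x / 2 ^ k)"

lemma flat_diff: "x \<le> y \<Longrightarrow> 0 \<le> flat k y - flat k x \<and> flat k y - flat k x \<le> y - x"
proof (induction k)
  case (Suc k)
  then have IH: "flat k x \<le> flat k y" "flat k y - flat k x \<le> y - x" by auto
  then have le: "flat k x / 2 ^ k \<le> flat k y / 2 ^ k" by (simp add: divide_right_mono)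
  have "flat (Suc k) y - flat (Suc k) x = 2 ^ k * (collapse (flat k y / 2 ^ k) - collapse (flat k x / 2 ^ k))"
    by (simp add: algebra_simps)
  moreover have "\<dots> \<le> 2 ^ k * (flat k y / 2 ^ k - flat k x / 2 ^ k)"
    using collapse_diff(2)[OF le] by (intro mult_left_mono) auto
  moreover have "2 ^ k * (flat k y / 2 ^ k - flat k x / 2 ^ k) = flat k y - flat k x"
    by (simp add: field_simps)
  moreover have "0 \<le> 2 ^ k * (collapse (flat k y / 2 ^ k) - collapse (flat k x / 2 ^ k))"
    using collapse_diff(1)[OF le] by (intro mult_nonneg_nonneg) auto
  ultimately show ?case using IH(2) by linarith
qed simp

lemma flat_mono: "x \<le> y \<Longrightarrow> flat k x \<le> flat k y"
  using flat_diff[of x y k] by linarith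

lemma flat_lipschitz: "\<bar>flat k x - flat k y\<bar> \<le> \<bar>x - y\<bar>"
  using flat_diff[of x y k] flat_diff[of y x k] by linarith

lemma flat_period: "flat k (x + 3 ^ k * of_int z) = flat k x + 2 ^ k * of_int z"
proof (induction k arbitrary: z)
  case (Suc k)
  have "flat k (x + 3 ^ Suc k * of_int z) = flat k (x + 3 ^ k * of_int (3 * z))"
    by (simp add: mult_ac)
  also have "\<dots> = flat k x + 2 ^ k * of_int (3 * z)" by (rule Suc)
  finally have "flat k (x + 3 ^ Suc k * of_int z) / 2 ^ k = flat k x / 2 ^ k + 3 * of_int z"
    by (simp add: field_simps)
  then have "flat (Suc k) (x + 3 ^ Suc k * of_int z) = 2 ^ k * (collapse (flat k x / 2 ^ k) + 2 * of_int z)"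
    by (simp only: flat.simps collapse_period)
  then show ?case
    by (simp add: distrib_left)
qed simp

lemma flat_minus: "flat k (- x) = - flat k x"
  by (induction k) (simp_all add: collapse_minus flip: minus_divide_left)

lemma flat_lattice: "flat k (3 ^ k * of_int z) = 2 ^ k * of_int z"
  using flat_period[of k 0 z] flat_minus[of k 0] by simp

lemma flat_reflect: "flat k (3 ^ k * of_int z - x) = 2 ^ k * of_int z - flat k x"
  using flat_period[of k "- x" z] by (simp add: flat_minus algebra_simps)

lemma flat_central:
  assumes "j < k" "central j p" "of_int p \<le> x" "x \<le> of_int p + 3 ^ j"
  shows "flat k x = flat k (of_int p)"
  using assms(1)
proof (induction k)
  case (Suc k)
  show ?case
  proof (cases "j = k")
    case False
    then show ?thesis using Suc by simp
  next
    case True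
    obtain u where u: "p = u * 3 ^ (k + 1) + 3 ^ k"
      using assms(2) True by (metis centralE)
    have p: "real_of_int p = 3 ^ k * of_int (3 * u + 1)" "real_of_int p + 3 ^ k = 3 ^ k * of_int (3 * u + 2)"
      by (simp_all add: u algebra_simps)
    have c: "collapse (flat k y / 2 ^ k) = 2 * of_int u + 1"
      if "of_int p \<le> y" "y \<le> of_int p + 3 ^ k" for y
    proof -
      have "2 ^ k * of_int (3 * u + 1) \<le> flat k y" "flat k y \<le> 2 ^ k * of_int (3 * u + 2)"
        using flat_mono[OF that(1), of k] flat_mono[OF that(2), of k] unfolding p(2)
        unfolding p(1) flat_lattice .
      then show ?thesis
        by (intro collapse_middle) (simp_all add: field_simps)
    qed
    show ?thesis
      using c[of x] c[of "of_int p"] assms(3,4) True by simp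
  qed
qed simp

section \<open>Rims of central squares\<close>

text \<open>
  The boundary of the square of side \<open>3 ^ j\<close> with corner \<open>(p, q)\<close>; used for integral points and
  for real ones.
\<close>

definition rim :: "nat \<Rightarrow> int \<Rightarrow> int \<Rightarrow> ('a::linordered_idom) \<Rightarrow> 'a \<Rightarrow> bool" where
  "rim j p q x y \<longleftrightarrow> of_int p \<le> x \<and> x \<le> of_int p + 3 ^ j \<and> of_int q \<le> y \<and> y \<le> of_int q + 3 ^ j \<and>
     (x = of_int p \<or> x = of_int p + 3 ^ j \<or> y = of_int q \<or> y = of_int q + 3 ^ j)"

lemma central_no_multiple:
  assumes "central j p" "p \<le> x" "x \<le> p + 3 ^ j"
  shows "\<not> 3 ^ Suc j dvd x"
proof
  assume "3 ^ Suc j dvd x"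
  then obtain w where w: "x = 3 ^ Suc j * w" ..
  obtain u where u: "p = u * 3 ^ (j + 1) + 3 ^ j"
    using assms(1) by (rule centralE)
  let ?B = "3 ^ j :: int"
  have B: "0 < ?B" by simp
  have "?B * (3 * u + 1) \<le> ?B * (3 * w)" "?B * (3 * w) \<le> ?B * (3 * u + 2)"
    using assms(2,3) by (simp_all add: w u algebra_simps)
  then have "3 * u + 1 \<le> 3 * w" "3 * w \<le> 3 * u + 2"
    using B by (simp_all only: mult_le_cancel_left_pos)
  then show False by presburger
qed

lemma central_dvd: "central j p \<Longrightarrow> 3 ^ j dvd p"
  by (metis centralE dvd_add dvd_refl dvd_triv_right dvd_mult le_imp_power_dvd le_add1)

lemma central_unique:
  assumes "central j p" "central j p'" "p \<le> x" "x \<le> p + 3 ^ j" "p' \<le> x" "x \<le> p' + 3 ^ j"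
  shows "p = p'"
proof -
  obtain u u' where u: "p = u * 3 ^ (j + 1) + 3 ^ j" "p' = u' * 3 ^ (j + 1) + 3 ^ j"
    using assms(1,2) by (metis centralE)
  let ?B = "3 ^ j :: int"
  have B: "0 < ?B" by simp
  have "?B * (3 * u) \<le> ?B * (3 * u' + 1)" "?B * (3 * u') \<le> ?B * (3 * u + 1)"
    using assms(3-6) by (simp_all add: u algebra_simps)
  then have "3 * u \<le> 3 * u' + 1" "3 * u' \<le> 3 * u + 1"
    using B by (simp_all only: mult_le_cancel_left_pos)
  then show ?thesis using u by auto
qed

lemma rim_not_nested:
  fixes x y :: int
  assumes "central j p" "central j q" "rim j p q x y"
    and "central j' p'" "central j' q'" "rim j' p' q' x y"
  shows "\<not> j < j'"
proof
  assume "j < j'"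
  then have d: "(3::int) ^ Suc j dvd 3 ^ j'" by (intro le_imp_power_dvd) simp
  have "3 ^ j' dvd p'" "3 ^ j' dvd p' + 3 ^ j'" "3 ^ j' dvd q'" "3 ^ j' dvd q' + 3 ^ j'"
    using assms(4,5) by (auto intro!: central_dvd dvd_add)
  then have "3 ^ j' dvd x \<or> 3 ^ j' dvd y"
    using assms(6) by (auto simp: rim_def)
  then have "3 ^ Suc j dvd x \<or> 3 ^ Suc j dvd y"
    using d dvd_trans by blast
  then show False
    using central_no_multiple[OF assms(1), of x] central_no_multiple[OF assms(2), of y] assms(3)
    by (auto simp: rim_def)
qed

text \<open>
  On the rim of a central square of side \<open>3 ^ j\<close> neither coordinate is a multiple of \<open>3 ^ (j + 1)\<close>,
  while on the rim of a larger one at least one of them is. Distinct central squares of equal side do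
  not touch, since they are centres of distinct triadic blocks.
\<close>

lemma rim_unique:
  fixes x y :: int
  assumes "central j p" "central j q" "rim j p q x y"
    and "central j' p'" "central j' q'" "rim j' p' q' x y"
  shows "j' = j \<and> p' = p \<and> q' = q"
proof -
  have j: "j = j'"
    using rim_not_nested[OF assms] rim_not_nested[OF assms(4-6,1-3)] by linarith
  have "p = p'"
    using assms(1,3,4,6) central_unique[of j p p' x] unfolding j rim_def by auto
  moreover have "q = q'"
    using assms(2,3,5,6) central_unique[of j q q' y] unfolding j rim_def by auto
  ultimately show ?thesis using j by simp
qed

text \<open>
  Each identification of opposite sides is a reflection in a midline of the square, possibly followed
  by the reflection in the other midline. Closure under both reflections therefore serves all
  identification types at once.
\<close>

definition reflect_closed :: "(int \<times> int) set \<Rightarrow> bool" where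
  "reflect_closed S \<longleftrightarrow>
     (\<forall>j p q x y. central j p \<longrightarrow> central j q \<longrightarrow> rim j p q x y \<longrightarrow> (x, y) \<in> S \<longrightarrow>
        (2 * p + 3 ^ j - x, y) \<in> S \<and> (x, 2 * q + 3 ^ j - y) \<in> S)"

definition triadic_lattice :: "nat \<Rightarrow> (int \<times> int) set" where
  "triadic_lattice k = {(x, y). 3 ^ k dvd x \<and> 3 ^ k dvd y}"

lemma lattice_rim:
  assumes "(x, y) \<in> triadic_lattice k" "central j p" "central j q" "rim j p q x y"
  shows "k \<le> j"
proof (rule ccontr)
  assume "\<not> k \<le> j"
  then have "(3::int) ^ Suc j dvd 3 ^ k" by (intro le_imp_power_dvd) simp
  then have "3 ^ Suc j dvd x"
    using assms(1) dvd_trans by (auto simp: triadic_lattice_def)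
  then show False
    using central_no_multiple[OF assms(2), of x] assms(4) by (auto simp: rim_def)
qed

text \<open>
  By disjointness of the rims, a point is moved by the reflections of a single square at
  most, and its orbit stays on the rim of that square. This bounds the number of blocks that can meet
  at a point after gluing.
\<close>

lemma reflect_closed_orbit:
  assumes "(x, y) \<in> triadic_lattice k"
  obtains S where "(x, y) \<in> S" "finite S" "card S \<le> 4" "reflect_closed S" "S \<subseteq> triadic_lattice k"
proof (cases "\<exists>j p q. central j p \<and> central j q \<and> rim j p q x y")
  case False
  then have "reflect_closed {(x, y)}"
    unfolding reflect_closed_def by blast
  then show ?thesis using that[of "{(x, y)}"] assms by simp
next
  case True
  then obtain j p q where c: "central j p" "central j q" and r: "rim j p q x y" by blast
  let ?x = "2 * p + 3 ^ j - x" and ?y = "2 * q + 3 ^ j - y"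
  let ?S = "{x, ?x} \<times> {y, ?y}"
  have rS: "rim j p q a b" if "(a, b) \<in> ?S" for a b
    using r that by (auto simp: rim_def)
  have "reflect_closed ?S"
    unfolding reflect_closed_def
  proof (intro allI impI)
    fix j' p' q' a b
    assume "central j' p'" "central j' q'" "rim j' p' q' a b" and ab: "(a, b) \<in> ?S"
    then have "j' = j \<and> p' = p \<and> q' = q"
      using rim_unique[OF c rS] by blast
    then show "(2 * p' + 3 ^ j' - a, b) \<in> ?S \<and> (a, 2 * q' + 3 ^ j' - b) \<in> ?S"
      using ab by auto
  qed
  moreover have "?S \<subseteq> triadic_lattice k"
  proof -
    have "k \<le> j" by (rule lattice_rim[OF assms c r])
    then have d: "(3::int) ^ k dvd 3 ^ j" by (rule le_imp_power_dvd)
    then have "3 ^ k dvd p" "3 ^ k dvd q"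
      using central_dvd c dvd_trans by blast+
    then show ?thesis
      using assms d by (auto simp: triadic_lattice_def)
  qed
  moreover have "card ?S \<le> 4"
  proof -
    have "card {x, ?x} \<le> 2" "card {y, ?y} \<le> 2" by (simp_all add: card_insert_if)
    then show ?thesis
      using mult_le_mono[of "card {x, ?x}" 2 "card {y, ?y}" 2] unfolding card_cartesian_product by simp
  qed
  ultimately show ?thesis using that[of ?S] by simp
qed

section \<open>Neighbourhoods that are compatible with the gluing\<close>

text \<open>
  The point \<open>(x, y)\<close> is at distance less than \<open>\<rho>\<close> from \<open>S\<close> in the maximum norm of the flattened
  coordinates.
\<close>

definition near :: "nat \<Rightarrow> (int \<times> int) set \<Rightarrow> real \<Rightarrow> real \<Rightarrow> real \<Rightarrow> bool" where
  "near k S \<rho> x y \<longleftrightarrow>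
     (\<exists>(a, b)\<in>S. \<bar>flat k x - flat k (of_int a)\<bar> < \<rho> \<and> \<bar>flat k y - flat k (of_int b)\<bar> < \<rho>)"

text \<open>
  Moving inside a closed cell changes each flattened coordinate by at most 1.
\<close>

lemma near_move:
  assumes "near k S \<rho> x y" "\<bar>x - x'\<bar> \<le> 1" "\<bar>y - y'\<bar> \<le> 1"
  shows "near k S (\<rho> + 1) x' y'"
proof -
  have "\<bar>flat k x - flat k x'\<bar> \<le> 1" "\<bar>flat k y - flat k y'\<bar> \<le> 1"
    using assms(2,3) flat_lipschitz order_trans by blast+
  then have "\<bar>flat k x - u\<bar> < \<rho> \<Longrightarrow> \<bar>flat k x' - u\<bar> < \<rho> + 1"
    "\<bar>flat k y - u\<bar> < \<rho> \<Longrightarrow> \<bar>flat k y' - u\<bar> < \<rho> + 1" for u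
    by linarith+
  then show ?thesis
    using assms(1) unfolding near_def by fast
qed

text \<open>
  Distinct multiples of \<open>3 ^ k\<close> are at least \<open>2 ^ k\<close> apart after flattening.
\<close>

lemma flat_close_in_interval:
  fixes a A B :: int
  assumes "3 ^ k dvd a" "3 ^ k dvd A" "3 ^ k dvd B" "of_int A \<le> x" "x \<le> of_int B"
    and "\<bar>flat k x - flat k (of_int a)\<bar> < 2 ^ k"
  shows "A \<le> a \<and> a \<le> B"
proof -
  obtain a' A' B' where [simp]: "a = 3 ^ k * a'" "A = 3 ^ k * A'" "B = 3 ^ k * B'"
    using assms(1-3) by (auto elim!: dvdE)
  have "flat k (of_int A) \<le> flat k x" "flat k x \<le> flat k (of_int B)"
    using assms(4,5) by (auto intro: flat_mono)
  then have "2 ^ k * real_of_int A' < 2 ^ k * of_int a' + 2 ^ k"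
    "2 ^ k * real_of_int a' < 2 ^ k * of_int B' + 2 ^ k"
    using assms(6) by (auto simp: flat_lattice abs_less_iff)
  then have "2 ^ k * real_of_int A' < 2 ^ k * of_int (a' + 1)"
    "2 ^ k * real_of_int a' < 2 ^ k * of_int (B' + 1)"
    by (simp_all add: algebra_simps)
  then have "A' < a' + 1" "a' < B' + 1"
    by (simp_all only: mult_less_cancel_left_pos zero_less_power zero_less_numeral of_int_less_iff)
  then show ?thesis by simp
qed

lemma rim_reflect:
  assumes "rim j p q x y"
  shows "rim j p q (of_int (2 * p + 3 ^ j) - x) y" "rim j p q x (of_int (2 * q + 3 ^ j) - y)"
  using assms by (auto simp: rim_def)

text \<open>
  Neighbourhoods of radius at most \<open>2 ^ k\<close> are invariant under the gluing. Small squares are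
  flattened to points. For a large square, the radius forces the lattice point that witnesses nearness
  onto the same side of the square, so it can be reflected together with the given point.
\<close>

lemma near_reflect_imp:
  assumes S: "reflect_closed S" "S \<subseteq> triadic_lattice k" and \<rho>: "\<rho> \<le> 2 ^ k"
    and c: "central j p" "central j q" and r: "rim j p q x y" and n: "near k S \<rho> x y"
  shows "near k S \<rho> (of_int (2 * p + 3 ^ j) - x) y" "near k S \<rho> x (of_int (2 * q + 3 ^ j) - y)"
proof -
  have xy: "of_int p \<le> x" "x \<le> of_int p + 3 ^ j" "of_int q \<le> y" "y \<le> of_int q + 3 ^ j"
    using r by (auto simp: rim_def)
  have "near k S \<rho> (of_int (2 * p + 3 ^ j) - x) y \<and> near k S \<rho> x (of_int (2 * q + 3 ^ j) - y)"
  proof (cases "j < k")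
    case True
    have "flat k (of_int (2 * w + 3 ^ j) - z) = flat k z"
      if "central j w" "of_int w \<le> z" "z \<le> of_int w + 3 ^ j" for w z
    proof -
      have "of_int w \<le> of_int (2 * w + 3 ^ j) - z" "of_int (2 * w + 3 ^ j) - z \<le> of_int w + 3 ^ j"
        using that(2,3) by simp_all
      then show ?thesis
        using flat_central[OF True that(1)] that(2,3) by metis
    qed
    then have "flat k (of_int (2 * p + 3 ^ j) - x) = flat k x"
      "flat k (of_int (2 * q + 3 ^ j) - y) = flat k y"
      using xy c by blast+
    then show ?thesis using n by (simp add: near_def)
  next
    case False
    then have d: "(3::int) ^ k dvd 3 ^ j" by (intro le_imp_power_dvd) simp
    then have dpq: "3 ^ k dvd p" "3 ^ k dvd p + 3 ^ j" "3 ^ k dvd q" "3 ^ k dvd q + 3 ^ j"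
      "3 ^ k dvd 2 * p + 3 ^ j" "3 ^ k dvd 2 * q + 3 ^ j"
      using central_dvd[OF c(1)] central_dvd[OF c(2)] dvd_trans by (auto intro!: dvd_add)
    obtain a b where ab: "(a, b) \<in> S"
      and na: "\<bar>flat k x - flat k (of_int a)\<bar> < \<rho>" and nb: "\<bar>flat k y - flat k (of_int b)\<bar> < \<rho>"
      using n by (auto simp: near_def)
    have dab: "3 ^ k dvd a" "3 ^ k dvd b"
      using ab S(2) by (auto simp: triadic_lattice_def)
    have ina: "A \<le> a \<and> a \<le> B" if "3 ^ k dvd A" "3 ^ k dvd B" "of_int A \<le> x" "x \<le> of_int B" for A B
      using flat_close_in_interval[OF dab(1) that] na \<rho> by simp
    have inb: "A \<le> b \<and> b \<le> B" if "3 ^ k dvd A" "3 ^ k dvd B" "of_int A \<le> y" "y \<le> of_int B" for A B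
      using flat_close_in_interval[OF dab(2) that] nb \<rho> by simp
    \<comment> \<open>A coordinate of the point that is a coordinate of a side is shared by the triadic_lattice point.\<close>
    have "a = p" if "x = of_int p" using ina[of p p] that dpq by simp
    moreover have "a = p + 3 ^ j" if "x = of_int p + 3 ^ j"
      using ina[of "p + 3 ^ j" "p + 3 ^ j"] that dpq by simp
    moreover have "b = q" if "y = of_int q" using inb[of q q] that dpq by simp
    moreover have "b = q + 3 ^ j" if "y = of_int q + 3 ^ j"
      using inb[of "q + 3 ^ j" "q + 3 ^ j"] that dpq by simp
    moreover have "p \<le> a \<and> a \<le> p + 3 ^ j" "q \<le> b \<and> b \<le> q + 3 ^ j"
      using ina[of p "p + 3 ^ j"] inb[of q "q + 3 ^ j"] xy dpq by simp_all
    ultimately have "rim j p q a b"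
      using r by (auto simp: rim_def)
    then have "(2 * p + 3 ^ j - a, b) \<in> S" "(a, 2 * q + 3 ^ j - b) \<in> S"
      using S(1) c ab unfolding reflect_closed_def by blast+
    moreover have "\<bar>flat k (of_int w - z) - flat k (of_int (w - v))\<bar> = \<bar>flat k z - flat k (of_int v)\<bar>"
      if w: "3 ^ k dvd w" for w v :: int and z :: real
    proof -
      obtain w' where "w = 3 ^ k * w'" using w ..
      then show ?thesis
        using flat_reflect[of k w' z] flat_reflect[of k w' "of_int v"] by simp
    qed
    ultimately show ?thesis
      unfolding near_def using na nb dpq(5,6) by (metis (no_types, lifting) case_prodI)
  qed
  then show "near k S \<rho> (of_int (2 * p + 3 ^ j) - x) y" "near k S \<rho> x (of_int (2 * q + 3 ^ j) - y)"
    by auto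
qed

lemma near_reflect:
  assumes "reflect_closed S" "S \<subseteq> triadic_lattice k" "\<rho> \<le> 2 ^ k" "central j p" "central j q" "rim j p q x y"
  shows "near k S \<rho> (of_int (2 * p + 3 ^ j) - x) y \<longleftrightarrow> near k S \<rho> x y"
    and "near k S \<rho> x (of_int (2 * q + 3 ^ j) - y) \<longleftrightarrow> near k S \<rho> x y"
proof -
  have twice: "of_int w - (of_int w - z) = z" for w :: int and z :: real by simp
  show "near k S \<rho> (of_int (2 * p + 3 ^ j) - x) y \<longleftrightarrow> near k S \<rho> x y"
    using near_reflect_imp(1)[OF assms]
      near_reflect_imp(1)[OF assms(1-5) rim_reflect(1)[OF assms(6)], unfolded twice] by blast
  show "near k S \<rho> x (of_int (2 * q + 3 ^ j) - y) \<longleftrightarrow> near k S \<rho> x y"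
    using near_reflect_imp(2)[OF assms]
      near_reflect_imp(2)[OF assms(1-5) rim_reflect(2)[OF assms(6)], unfolded twice] by blast
qed

lemma glue_near:
  assumes S: "reflect_closed S" "S \<subseteq> triadic_lattice k" "\<rho> \<le> 2 ^ k" and "glue \<tau> m P P'"
  shows "near k S \<rho> (fst P) (snd P) \<longleftrightarrow> near k S \<rho> (fst P') (snd P')"
  using assms(4)
proof cases
  case (left_right j p q t)
  note c = vacant_imp_central[OF left_right(3)]
  have r: "rim j p q (real_of_int p) (of_int q + t)"
    using left_right by (auto simp: rim_def)
  have 1: "near k S \<rho> (of_int p + 3 ^ j) (of_int q + t) \<longleftrightarrow> near k S \<rho> (fst P) (snd P)"
    using near_reflect(1)[OF S c r] left_right by simp
  have "near k S \<rho> (of_int p + 3 ^ j) (of_int q + (3 ^ j - t)) \<longleftrightarrow>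
      near k S \<rho> (of_int p + 3 ^ j) (of_int q + t)"
    using near_reflect(2)[OF S c rim_reflect(1)[OF r]] by (simp add: algebra_simps)
  then show ?thesis using 1 left_right(2) by auto
next
  case (bottom_top j p q t)
  note c = vacant_imp_central[OF bottom_top(3)]
  have r: "rim j p q (of_int p + t) (real_of_int q)"
    using bottom_top by (auto simp: rim_def)
  have 1: "near k S \<rho> (of_int p + t) (of_int q + 3 ^ j) \<longleftrightarrow> near k S \<rho> (fst P) (snd P)"
    using near_reflect(2)[OF S c r] bottom_top by simp
  have "near k S \<rho> (of_int p + (3 ^ j - t)) (of_int q + 3 ^ j) \<longleftrightarrow>
      near k S \<rho> (of_int p + t) (of_int q + 3 ^ j)"
    using near_reflect(1)[OF S c rim_reflect(2)[OF r]] by (simp add: algebra_simps)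
  then show ?thesis using 1 bottom_top(2) by auto
qed

lemma equivclp_glue_near:
  assumes "reflect_closed S" "S \<subseteq> triadic_lattice k" "\<rho> \<le> 2 ^ k" and "equivclp (glue \<tau> m) P P'"
  shows "near k S \<rho> (fst P) (snd P) \<longleftrightarrow> near k S \<rho> (fst P') (snd P')"
  using assms(4)
proof (induction rule: equivclp_induct)
  case (step y z)
  then show ?case using glue_near[OF assms(1-3)] by blast
qed simp

lemma unit_edge_point:
  assumes "E \<in> unit_edges (a, b)" "P \<in> E"
  shows "\<bar>of_int a - fst P\<bar> \<le> 1" "\<bar>of_int b - snd P\<bar> \<le> 1"
  using assms unfolding unit_edges_def by auto

lemma unit_edge_nonempty: "E \<in> unit_edges c \<Longrightarrow> E \<noteq> {}"
  unfolding unit_edges_def by (cases c) (auto dest: sym)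

text \<open>
  A step is followed by going from the corner of the first cell to a point of the shared edge,
  across the gluing at no cost, and on to the corner of the second cell.
\<close>

lemma V_adj_near:
  assumes S: "reflect_closed S" "S \<subseteq> triadic_lattice k" and \<rho>: "\<rho> + 1 \<le> 2 ^ k"
    and adj: "V_adj \<tau> m (a, b) (a', b')" and n: "near k S \<rho> (of_int a) (of_int b)"
  shows "near k S (\<rho> + 2) (of_int a') (of_int b')"
proof -
  obtain E E' where E: "E \<in> unit_edges (a, b)" "E' \<in> unit_edges (a', b')"
    and eq: "glue_class \<tau> m ` E = glue_class \<tau> m ` E'"
    using adj unfolding V_adj_def by blast
  obtain P where P: "P \<in> E" using unit_edge_nonempty[OF E(1)] by blast
  then obtain P' where P': "P' \<in> E'" "equivclp (glue \<tau> m) P P'"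
    using eq unfolding glue_class_image_eq_iff by blast
  have "near k S (\<rho> + 1) (fst P) (snd P)"
    using near_move[OF n] unit_edge_point[OF E(1) P] by blast
  then have "near k S (\<rho> + 1) (fst P') (snd P')"
    using equivclp_glue_near[OF S \<rho> P'(2)] by blast
  then have "near k S (\<rho> + 1 + 1) (of_int a') (of_int b')"
    using unit_edge_point[OF E(2) P'(1)] by (elim near_move) (simp_all add: abs_minus_commute)
  then show ?thesis by (simp add: add.assoc)
qed

lemma V_path_near:
  assumes S: "reflect_closed S" "S \<subseteq> triadic_lattice k"
    and "\<rho> + 2 * real n \<le> 2 ^ k" "(V_adj \<tau> m ^^ n) c c'"
    and "near k S \<rho> (of_int (fst c)) (of_int (snd c))"
  shows "near k S (\<rho> + 2 * real n) (of_int (fst c')) (of_int (snd c'))"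
  using assms(3-)
proof (induction n arbitrary: c')
  case (Suc n)
  obtain d where d: "(V_adj \<tau> m ^^ n) c d" "V_adj \<tau> m d c'"
    using Suc.prems(2) by (rule relpowp_Suc_E)
  have "near k S (\<rho> + 2 * real n) (of_int (fst d)) (of_int (snd d))"
    using Suc d by simp
  then have "near k S (\<rho> + 2 * real n + 2) (of_int (fst c')) (of_int (snd c'))"
    using V_adj_near[OF S, of "\<rho> + 2 * real n" \<tau> m "fst d" "snd d" "fst c'" "snd c'"] Suc.prems(1) d(2)
    by simp
  then show ?case by (simp add: algebra_simps)
qed simp

section \<open>Counting the cells in a ball\<close>

lemma card_block_le:
  assumes "k \<le> m"
  shows "finite {c \<in> V_cells m. (fst c div 3 ^ k, snd c div 3 ^ k) = d} \<and>
    card {c \<in> V_cells m. (fst c div 3 ^ k, snd c div 3 ^ k) = d} \<le> 8 ^ k"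
proof -
  let ?B = "{c \<in> V_cells m. (fst c div 3 ^ k, snd c div 3 ^ k) = d}"
  let ?f = "\<lambda>c :: int \<times> int. (fst c mod 3 ^ k, snd c mod 3 ^ k)"
  have "digit3 j (a mod 3 ^ k) = digit3 j a" if "j < k" for j and a :: int
    using digit3_shift[OF that, of "a mod 3 ^ k" "a div 3 ^ k"] by simp
  then have "?f c \<in> V_cells k" if "c \<in> V_cells m" for c
    using that assms by (simp add: V_cells_def split: prod.splits)
  then have "?f ` ?B \<subseteq> V_cells k" by blast
  moreover have "inj_on ?f ?B"
  proof (rule inj_onI)
    fix c c' assume "c \<in> ?B" "c' \<in> ?B" "?f c = ?f c'"
    then have "fst c div 3 ^ k = fst c' div 3 ^ k" "fst c mod 3 ^ k = fst c' mod 3 ^ k"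
      "snd c div 3 ^ k = snd c' div 3 ^ k" "snd c mod 3 ^ k = snd c' mod 3 ^ k"
      by auto
    then have "fst c = fst c'" "snd c = snd c'"
      by (metis mult_div_mod_eq)+
    then show "c = c'" by (rule prod_eqI)
  qed
  ultimately show ?thesis
    using card_inj_on_le[of ?f ?B "V_cells k"] card_V_cells[of k] card_V_cells[of m] by auto
qed

lemma block_floor:
  fixes z :: int
  shows "3 ^ k * (z div 3 ^ k) \<le> z" "z \<le> 3 ^ k * (z div 3 ^ k + 1)"
proof -
  have "3 ^ k * (z div 3 ^ k) + z mod 3 ^ k = z" "0 \<le> z mod 3 ^ k" "z mod 3 ^ k < 3 ^ k"
    by simp_all
  then show "3 ^ k * (z div 3 ^ k) \<le> z" "z \<le> 3 ^ k * (z div 3 ^ k + 1)"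
    unfolding distrib_left by linarith+
qed

text \<open>
  A flattened block of side \<open>3 ^ (k + 1)\<close> has side \<open>2 * 2 ^ k\<close>, so one of its ends is within \<open>2 ^ k\<close>.
\<close>

lemma nearest_lattice_coordinate:
  obtains a' :: int where "3 ^ Suc k dvd a'" "\<bar>flat (Suc k) (of_int a) - flat (Suc k) (of_int a')\<bar> \<le> 2 ^ k"
proof -
  define A where "A = a div 3 ^ Suc k"
  have A: "3 ^ Suc k * A \<le> a" "a \<le> 3 ^ Suc k * (A + 1)"
    unfolding A_def by (rule block_floor)+
  have l: "flat (Suc k) (of_int (3 ^ Suc k * z)) = 2 * 2 ^ k * of_int z" for z
    using flat_lattice[of "Suc k" z] by (simp del: flat.simps)
  have "flat (Suc k) (of_int (3 ^ Suc k * A)) \<le> flat (Suc k) (of_int a)"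
    "flat (Suc k) (of_int a) \<le> flat (Suc k) (of_int (3 ^ Suc k * (A + 1)))"
    using A by (auto intro!: flat_mono simp del: flat.simps power_Suc simp flip: of_int_mult)
  then have *: "2 * 2 ^ k * of_int A \<le> flat (Suc k) (of_int a)"
    "flat (Suc k) (of_int a) \<le> 2 * 2 ^ k * of_int A + 2 * 2 ^ k"
    unfolding l by (simp_all add: algebra_simps del: flat.simps)
  have l': "flat (Suc k) (of_int (3 ^ Suc k * (A + 1))) = 2 * 2 ^ k * of_int A + 2 * 2 ^ k"
    unfolding l by (simp add: distrib_left)
  show ?thesis
  proof (cases "flat (Suc k) (of_int a) \<le> 2 * 2 ^ k * of_int A + 2 ^ k")
    case True
    then have "\<bar>flat (Suc k) (of_int a) - flat (Suc k) (of_int (3 ^ Suc k * A))\<bar> \<le> 2 ^ k"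
      using * unfolding l by linarith
    then show ?thesis by (rule that[OF dvd_triv_left])
  next
    case False
    then have "\<bar>flat (Suc k) (of_int a) - flat (Suc k) (of_int (3 ^ Suc k * (A + 1)))\<bar> \<le> 2 ^ k"
      using * unfolding l' by linarith
    then show ?thesis by (rule that[OF dvd_triv_left])
  qed
qed

text \<open>
  Let \<open>k = l + 2\<close> and let \<open>S\<close> be the orbit of a corner of the block of side \<open>3 ^ k\<close> around \<open>x\<close> that
  is nearest to \<open>x\<close>. The distance of \<open>x\<close> from \<open>S\<close> is at most \<open>2 ^ (k - 1)\<close>, and fewer than \<open>2 ^ l\<close>
  steps increase it by at most \<open>2 ^ (k - 1) - 2\<close>. Hence the path stays in blocks that have one of the at
  most four points of \<open>S\<close> as a corner, of which there are at most 16, with at most \<open>8 ^ k\<close> cells each.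
\<close>

lemma card_V_ball_le:
  assumes "l + 2 \<le> m"
  shows "card {y \<in> V_cells m. \<exists>n<2 ^ l. (V_adj \<tau> m ^^ n) x y} \<le> 16 * 8 ^ (l + 2)"
proof -
  define k where "k = l + 2"
  let ?Y = "{y \<in> V_cells m. \<exists>n<2 ^ l. (V_adj \<tau> m ^^ n) x y}"
  let ?r = "2 ^ Suc l + 1 :: real"
  obtain a b where ab: "(a, b) \<in> triadic_lattice k"
    and na: "\<bar>flat k (of_int (fst x)) - flat k (of_int a)\<bar> \<le> 2 ^ Suc l"
    and nb: "\<bar>flat k (of_int (snd x)) - flat k (of_int b)\<bar> \<le> 2 ^ Suc l"
  proof -
    obtain a where "3 ^ Suc (Suc l) dvd a"
      "\<bar>flat (Suc (Suc l)) (of_int (fst x)) - flat (Suc (Suc l)) (of_int a)\<bar> \<le> 2 ^ Suc l"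
      by (rule nearest_lattice_coordinate)
    moreover obtain b where "3 ^ Suc (Suc l) dvd b"
      "\<bar>flat (Suc (Suc l)) (of_int (snd x)) - flat (Suc (Suc l)) (of_int b)\<bar> \<le> 2 ^ Suc l"
      by (rule nearest_lattice_coordinate)
    moreover have "k = Suc (Suc l)" by (simp add: k_def)
    ultimately show ?thesis
      by (intro that[of a b]) (simp_all add: triadic_lattice_def del: flat.simps power_Suc)
  qed
  obtain S where S: "(a, b) \<in> S" "finite S" "card S \<le> 4" "reflect_closed S" "S \<subseteq> triadic_lattice k"
    using reflect_closed_orbit[OF ab] .
  \<comment> \<open>Nearness is a strict inequality, hence the extra 1 in the radius.\<close>
  have start: "near k S ?r (of_int (fst x)) (of_int (snd x))"
    unfolding near_def using na nb by (intro bexI[OF _ S(1)]) auto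
  define T where "T = (\<Union>(u, v)\<in>S. {u div 3 ^ k - 1, u div 3 ^ k} \<times> {v div 3 ^ k - 1, v div 3 ^ k})"
  have T: "finite T" "card T \<le> 16"
  proof -
    show "finite T" using S(2) by (auto simp: T_def)
    have "card T \<le> (\<Sum>w\<in>S. card (case w of (u, v) \<Rightarrow>
        {u div 3 ^ k - 1, u div 3 ^ k} \<times> {v div 3 ^ k - 1, v div 3 ^ k}))"
      unfolding T_def by (rule card_UN_le[OF S(2)])
    also have "\<dots> \<le> (\<Sum>w\<in>S. 4)"
      by (rule sum_mono) (auto simp: card_cartesian_product split: prod.split)
    finally show "card T \<le> 16" using S(3) by simp
  qed
  have "(fst y div 3 ^ k, snd y div 3 ^ k) \<in> T" if y: "y \<in> ?Y" for y
  proof -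
    obtain n where n: "n < 2 ^ l" "(V_adj \<tau> m ^^ n) x y" using y by blast
    have "real n + 1 \<le> 2 ^ l"
      using n(1) by (metis Suc_leI of_nat_Suc of_nat_le_iff of_nat_numeral of_nat_power add.commute)
    then have "?r + 2 * real n \<le> 2 ^ k" by (simp add: k_def)
    then have "near k S (?r + 2 * real n) (of_int (fst y)) (of_int (snd y))"
      and le: "?r + 2 * real n \<le> 2 ^ k"
      using V_path_near[OF S(4,5) _ n(2) start] by auto
    then obtain u v where uv: "(u, v) \<in> S" "\<bar>flat k (of_int (fst y)) - flat k (of_int u)\<bar> < 2 ^ k"
      "\<bar>flat k (of_int (snd y)) - flat k (of_int v)\<bar> < 2 ^ k"
      unfolding near_def by force
    have "z div 3 ^ k \<in> {w div 3 ^ k - 1, w div 3 ^ k}"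
      if w: "3 ^ k dvd w" and c: "\<bar>flat k (of_int z) - flat k (of_int w)\<bar> < 2 ^ k" for z w :: int
    proof -
      define Z where "Z = z div 3 ^ k"
      have Z: "3 ^ k * Z \<le> z" "z \<le> 3 ^ k * (Z + 1)"
        unfolding Z_def by (rule block_floor)+
      have "3 ^ k * Z \<le> w \<and> w \<le> 3 ^ k * (Z + 1)"
        by (rule flat_close_in_interval[OF w _ _ _ _ c]) (use Z in \<open>simp_all only: of_int_le_iff dvd_triv_left\<close>)
      moreover obtain w' where "w = 3 ^ k * w'" using w ..
      ultimately have "Z \<le> w'" "w' \<le> Z + 1" "w div 3 ^ k = w'"
        by (simp_all del: distrib_left)
      then show ?thesis unfolding Z_def by auto
    qed
    then have "fst y div 3 ^ k \<in> {u div 3 ^ k - 1, u div 3 ^ k}" "snd y div 3 ^ k \<in> {v div 3 ^ k - 1, v div 3 ^ k}"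
      using uv S(5) unfolding triadic_lattice_def by blast+
    then show ?thesis using uv(1) unfolding T_def by blast
  qed
  then have "?Y \<subseteq> (\<Union>d\<in>T. {c \<in> V_cells m. (fst c div 3 ^ k, snd c div 3 ^ k) = d})"
    by blast
  moreover have B: "finite {c \<in> V_cells m. (fst c div 3 ^ k, snd c div 3 ^ k) = d}"
    "card {c \<in> V_cells m. (fst c div 3 ^ k, snd c div 3 ^ k) = d} \<le> 8 ^ k" for d
    using card_block_le[of k m d] assms by (auto simp: k_def)
  ultimately have "card ?Y \<le> card (\<Union>d\<in>T. {c \<in> V_cells m. (fst c div 3 ^ k, snd c div 3 ^ k) = d})"
    using T(1) by (intro card_mono) auto
  also have "\<dots> \<le> (\<Sum>d\<in>T. card {c \<in> V_cells m. (fst c div 3 ^ k, snd c div 3 ^ k) = d})"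
    by (rule card_UN_le[OF T(1)])
  also have "\<dots> \<le> (\<Sum>d\<in>T. 8 ^ k)" by (rule sum_mono[OF B(2)])
  also have "\<dots> \<le> 16 * 8 ^ k" using T(2) by simp
  finally show ?thesis by (simp add: k_def)
qed

section \<open>Balls in the infinite magic carpet\<close>

lemma offset_Suc: "c + offset e (Suc m) = (c + offset e m) + block_shift m (e m)"
  by (simp add: block_shift_def add.assoc)

lemma IMC_cells_eventually:
  assumes "\<And>m. e m \<in> copy_positions" "c \<in> IMC_cells e"
  shows "\<forall>\<^sub>F m in sequentially. c + offset e m \<in> V_cells m"
proof -
  obtain m0 where m0: "c + offset e m0 \<in> V_cells m0"
    using assms(2) by (auto simp: IMC_cells_def)
  have "c + offset e m \<in> V_cells m" if "m0 \<le> m" for m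
    using that
  proof (induction m rule: dec_induct)
    case (step m)
    then show ?case unfolding offset_Suc using V_cells_copy assms(1) by blast
  qed (fact m0)
  then show ?thesis unfolding eventually_sequentially by blast
qed

text \<open>
  The edges of a path may come from different finite complexes; since adjacency is inherited by the
  larger ones, the whole path lives in all sufficiently large complexes.
\<close>

lemma IMC_path_eventually:
  assumes e: "\<And>m. e m \<in> copy_positions" and "(IMC_adj \<tau> e ^^ n) c c'"
  shows "\<forall>\<^sub>F m in sequentially. (V_adj \<tau> m ^^ n) (c + offset e m) (c' + offset e m)"
  using assms(2)
proof (induction n arbitrary: c')
  case (Suc n)
  obtain d where d: "(IMC_adj \<tau> e ^^ n) c d" "IMC_adj \<tau> e d c'"
    using Suc.prems by (rule relpowp_Suc_E)
  obtain m0 where m0: "V_adj \<tau> m0 (d + offset e m0) (c' + offset e m0)"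
    using d(2) by (auto simp: IMC_adj_def)
  have "V_adj \<tau> m (d + offset e m) (c' + offset e m)" if "m0 \<le> m" for m
    using that
  proof (induction m rule: dec_induct)
    case (step m)
    then show ?case unfolding offset_Suc using V_adj_copy e by blast
  qed (fact m0)
  then have "\<forall>\<^sub>F m in sequentially. V_adj \<tau> m (d + offset e m) (c' + offset e m)"
    unfolding eventually_sequentially by blast
  with Suc.IH[OF d(1)] show ?case
    by eventually_elim (rule relpowp_Suc_I)
qed simp

lemma V_path_imp_IMC_path:
  assumes "(V_adj \<tau> m ^^ n) (c + offset e m) (c' + offset e m)"
  shows "(IMC_adj \<tau> e ^^ n) c c'"
  using assms
proof (induction n arbitrary: c')
  case (Suc n)
  obtain d where d: "(V_adj \<tau> m ^^ n) (c + offset e m) d" "V_adj \<tau> m d (c' + offset e m)"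
    using Suc.prems by (rule relpowp_Suc_E)
  have *: "d = (d - offset e m) + offset e m" by simp
  have "(IMC_adj \<tau> e ^^ n) c (d - offset e m)"
    using d(1) by (intro Suc.IH) simp
  moreover have "IMC_adj \<tau> e (d - offset e m) c'"
    using d(2) unfolding IMC_adj_def by (intro exI[of _ m]) simp
  ultimately show ?case by (rule relpowp_Suc_I)
qed simp

lemma IMC_ball_iff:
  "y \<in> IMC_ball \<tau> e x r \<longleftrightarrow> y \<in> IMC_cells e \<and> (\<exists>n. real n < r \<and> (IMC_adj \<tau> e ^^ n) x y)"
proof -
  let ?A = "{enat n |n. (IMC_adj \<tau> e ^^ n) x y}"
  have "ereal_of_enat (Inf ?A) < ereal r \<longleftrightarrow> (\<exists>n. real n < r \<and> (IMC_adj \<tau> e ^^ n) x y)"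
  proof
    assume *: "ereal_of_enat (Inf ?A) < ereal r"
    have "?A \<noteq> {}"
    proof
      assume "?A = {}"
      then have "ereal_of_enat (Inf ?A) = \<infinity>" by (simp only: Inf_enat_def) simp
      then show False using * by simp
    qed
    then obtain k where "k \<in> ?A" by blast
    then have "Inf ?A \<in> ?A"
      unfolding Inf_enat_def by (auto intro: LeastI)
    then obtain n where "Inf ?A = enat n" "(IMC_adj \<tau> e ^^ n) x y" by blast
    then show "\<exists>n. real n < r \<and> (IMC_adj \<tau> e ^^ n) x y" using * by auto
  next
    assume "\<exists>n. real n < r \<and> (IMC_adj \<tau> e ^^ n) x y"
    then obtain n where n: "real n < r" "(IMC_adj \<tau> e ^^ n) x y" by blast
    then have "Inf ?A \<le> enat n" by (intro Inf_lower) blast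
    then have "ereal_of_enat (Inf ?A) \<le> ereal_of_enat (enat n)"
      by (simp only: ereal_of_enat_le_iff)
    then show "ereal_of_enat (Inf ?A) < ereal r"
      using n(1) by (simp add: le_less_trans)
  qed
  then show ?thesis by (simp add: IMC_ball_def IMC_dist_def)
qed

text \<open>
  The bound is first shown for finite subsets of the ball, because a finite set of cells and of paths
  to them fits into a single finite complex. Finiteness of the ball follows.
\<close>

lemma card_IMC_ball_le:
  assumes e: "\<And>m. e m \<in> copy_positions" and r: "r \<le> 2 ^ l"
  shows "finite (IMC_ball \<tau> e x r) \<and> card (IMC_ball \<tau> e x r) \<le> 16 * 8 ^ (l + 2)"
proof -
  have "card F \<le> 16 * 8 ^ (l + 2)" if F: "F \<subseteq> IMC_ball \<tau> e x r" "finite F" for F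
  proof -
    have "\<forall>\<^sub>F m in sequentially. y + offset e m \<in> V_cells m \<and>
        (\<exists>n<2 ^ l. (V_adj \<tau> m ^^ n) (x + offset e m) (y + offset e m))" if "y \<in> F" for y
    proof -
      obtain n where n: "y \<in> IMC_cells e" "real n < r" "(IMC_adj \<tau> e ^^ n) x y"
        using \<open>y \<in> F\<close> F(1) unfolding subset_iff IMC_ball_iff by blast
      have "real n < 2 ^ l" using n(2) r by (rule less_le_trans)
      then have "n < 2 ^ l" by simp
      then show ?thesis
        using IMC_cells_eventually[OF e n(1)] IMC_path_eventually[OF e n(3)]
        by (auto elim: eventually_elim2)
    qed
    then have "\<forall>\<^sub>F m in sequentially. \<forall>y\<in>F. y + offset e m \<in> V_cells m \<and>
        (\<exists>n<2 ^ l. (V_adj \<tau> m ^^ n) (x + offset e m) (y + offset e m))"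
      using F(2) by (intro eventually_ball_finite) auto
    then have "\<forall>\<^sub>F m in sequentially. l + 2 \<le> m \<and> (\<forall>y\<in>F. y + offset e m \<in> V_cells m \<and>
        (\<exists>n<2 ^ l. (V_adj \<tau> m ^^ n) (x + offset e m) (y + offset e m)))"
      using eventually_ge_at_top by (rule eventually_conj[rotated])
    then obtain m where m: "l + 2 \<le> m" "\<forall>y\<in>F. y + offset e m \<in> V_cells m \<and>
        (\<exists>n<2 ^ l. (V_adj \<tau> m ^^ n) (x + offset e m) (y + offset e m))"
      unfolding eventually_sequentially by blast
    let ?Y = "{y \<in> V_cells m. \<exists>n<2 ^ l. (V_adj \<tau> m ^^ n) (x + offset e m) y}"
    have "card F = card ((\<lambda>y. y + offset e m) ` F)"
      by (rule card_image[symmetric]) (simp add: inj_on_def)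
    also have "\<dots> \<le> card ?Y"
      using m(2) card_V_cells[of m] by (intro card_mono) auto
    also have "\<dots> \<le> 16 * 8 ^ (l + 2)"
      by (rule card_V_ball_le[OF m(1)])
    finally show ?thesis .
  qed
  then show ?thesis
    using finite_if_finite_subsets_card_bdd by blast
qed

lemma card_IMC_ball_ge:
  assumes e: "\<And>m. e m \<in> copy_positions" and x: "x + offset e m \<in> V_cells m"
    and r: "48 * 2 ^ m < r" and fin: "finite (IMC_ball \<tau> e x r)"
  shows "8 ^ m \<le> card (IMC_ball \<tau> e x r)"
proof -
  have "(\<lambda>c. c - offset e m) ` V_cells m \<subseteq> IMC_ball \<tau> e x r"
  proof (rule image_subsetI)
    fix c assume c: "c \<in> V_cells m"
    obtain n where n: "n \<le> 48 * 2 ^ m" "(V_adj \<tau> m ^^ n) (x + offset e m) c"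
      using diameter[OF x c, of \<tau>] unfolding joined_def by blast
    have "(IMC_adj \<tau> e ^^ n) x (c - offset e m)"
      using n(2) by (intro V_path_imp_IMC_path[where m = m]) simp
    moreover have "real n \<le> real (48 * 2 ^ m)" using n(1) by (simp only: of_nat_le_iff)
    then have "real n < r" using r by simp
    moreover have "c - offset e m \<in> IMC_cells e"
      unfolding IMC_cells_def using c by (auto intro!: exI[of _ m])
    ultimately show "c - offset e m \<in> IMC_ball \<tau> e x r"
      unfolding IMC_ball_iff by blast
  qed
  then have "card ((\<lambda>c. c - offset e m) ` V_cells m) \<le> card (IMC_ball \<tau> e x r)"
    by (rule card_mono[OF fin])
  then show ?thesis
    using card_V_cells[of m] by (simp add: card_image inj_on_def)
qed

lemma power_of_2_between:
  fixes r :: real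
  assumes "1 \<le> r"
  obtains l :: nat where "r \<le> 2 ^ l" "2 ^ l \<le> 2 * r"
proof -
  obtain n :: nat where "r < 2 ^ n" using real_arch_pow[of 2 r] by auto
  then have ex: "r \<le> 2 ^ n" by simp
  define l where "l = (LEAST n. r \<le> 2 ^ n)"
  have l: "r \<le> 2 ^ l" unfolding l_def using ex by (rule LeastI)
  have "2 ^ l \<le> 2 * r"
  proof (cases l)
    case 0
    then show ?thesis using assms by simp
  next
    case (Suc k)
    then have "\<not> r \<le> 2 ^ k" using not_less_Least[of k "\<lambda>n. r \<le> 2 ^ n"] by (simp add: l_def)
    then show ?thesis using Suc by simp
  qed
  with l show ?thesis by (rule that)
qed

theorem theorem2p19:
  fixes \<tau> :: identification
    and e :: "nat \<Rightarrow> int \<times> int"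
    and x :: "int \<times> int"
  assumes "generic_choice e"
    and "x \<in> IMC_cells e"
  shows "\<exists>c C :: real. c > 0 \<and> C > 0 \<and>
           (\<forall>\<^sub>F r in at_top.
              c * r ^ 3 \<le> real (card (IMC_ball \<tau> e x r)) \<and>
              real (card (IMC_ball \<tau> e x r)) \<le> C * r ^ 3)"
proof -
  have e: "e m \<in> copy_positions" for m
    using assms(1) by (simp add: generic_choice_def)
  have cube: "(8::real) ^ l = (2 ^ l) ^ 3" for l
    by (simp flip: power_mult add: mult.commute[of l]) (simp add: power_mult)
  obtain m0 where m0: "\<And>m. m0 \<le> m \<Longrightarrow> x + offset e m \<in> V_cells m"
    using IMC_cells_eventually[OF e assms(2)] unfolding eventually_sequentially by blast
  have "(1 / 10 ^ 6) * r ^ 3 \<le> real (card (IMC_ball \<tau> e x r)) \<and>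
      real (card (IMC_ball \<tau> e x r)) \<le> 8192 * r ^ 3"
    if r: "100 * 2 ^ m0 \<le> r" for r :: real
  proof
    have "(1::real) \<le> 2 ^ m0" by simp
    then have r100: "100 \<le> r" using r by linarith
    obtain l where l: "r \<le> 2 ^ l" "2 ^ l \<le> 2 * r"
      using power_of_2_between[of r] r100 by auto
    have ball: "finite (IMC_ball \<tau> e x r)" "card (IMC_ball \<tau> e x r) \<le> 16 * 8 ^ (l + 2)"
      using card_IMC_ball_le[of e r l \<tau> x] e l(1) by blast+
    have "real (card (IMC_ball \<tau> e x r)) \<le> real (16 * 8 ^ (l + 2))"
      using ball(2) by (simp only: of_nat_le_iff)
    also have "\<dots> = 1024 * (2 ^ l) ^ 3" by (simp add: cube)
    also have "\<dots> \<le> 1024 * (2 * r) ^ 3"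
      using l(2) by (intro mult_left_mono power_mono) auto
    also have "\<dots> = 8192 * r ^ 3" by (simp add: power_mult_distrib)
    finally show "real (card (IMC_ball \<tau> e x r)) \<le> 8192 * r ^ 3" .
    obtain m where m: "r / 100 \<le> 2 ^ m" "2 ^ m \<le> 2 * (r / 100)"
      using power_of_2_between[of "r / 100"] r100 by auto
    have "(2::real) ^ m0 \<le> 2 ^ m" using m(1) r by linarith
    then have "m0 \<le> m" by simp
    have "48 * 2 ^ m < r" using m(2) r100 by linarith
    then have "8 ^ m \<le> card (IMC_ball \<tau> e x r)"
      using card_IMC_ball_ge[of e x m r \<tau>] e m0[OF \<open>m0 \<le> m\<close>] ball(1) by blast
    then have "real (8 ^ m) \<le> real (card (IMC_ball \<tau> e x r))" by (simp only: of_nat_le_iff)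
    moreover have "(r / 100) ^ 3 \<le> (2 ^ m) ^ 3"
      using m(1) r100 by (intro power_mono) auto
    ultimately show "(1 / 10 ^ 6) * r ^ 3 \<le> real (card (IMC_ball \<tau> e x r))"
      by (simp add: cube power_divide)
  qed
  then have "\<forall>\<^sub>F r in at_top. (1 / 10 ^ 6) * r ^ 3 \<le> real (card (IMC_ball \<tau> e x r)) \<and>
      real (card (IMC_ball \<tau> e x r)) \<le> 8192 * r ^ 3"
    by (rule eventually_mono[OF eventually_ge_at_top])
  then show ?thesis
    by (intro exI[of _ "1 / 10 ^ 6"] exI[of _ 8192] conjI) simp_all
qed

end
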